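(* Let $X$ and $Y$ be Banach spaces such that $Y$ has quasi-$\operatorname{ACK}$ structure with a $1$-norming set $\Gamma\subseteq B_{Y^*}$ and a function $\rho\colon\Gamma\to[0,1)$. Let $T\in\mathcal{L}(X,Y)$ be a $\Gamma$-flat operator such that $T$ is $\Gamma_0$-flat for every $\Gamma_0\subseteq\Gamma$. (a) If $\operatorname{SE}(B_X)$ is dense in $X^*$, then given $\varepsilon>0$ there exists $R\in\operatorname{ASE}(X,Y)$ such that $\|R-T\|<\varepsilon$. (b) If the set $\operatorname{smo}(X^* )\cap\operatorname{NA}(X)$ is dense in $X^*$ (in particular, if $X$ is strictly convex), then given $\varepsilon>0$ there exists $R\in\mathcal{L}(X,Y)$ such that $\|R-T\|<\varepsilon$, $\|R(x_0)\|=\|R\|$ for some $x_0\in S_X$, and whenever a sequence $(x_n)\subseteq B_X$ satisfies $\|Rx_n\|\to\|R\|$, there exists a subsequence $(x_{\sigma(n)})$ of $(x_n)$ such that $(x_{\sigma(n)})$ converges weakly to $\theta x_0$ for some $\theta\in\mathbb{T}$.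
   Context: Banach spaces are over $\mathbb{K}$, where $\mathbb{K}=\mathbb{R}$ or $\mathbb{C}$, and are nonzero. $\mathbb{T}=\{\theta\in\mathbb{K}\colon|\theta|=1\}$; $B_X$, $S_X$ are the closed unit ball and unit sphere; $\mathcal{L}(X,Y)$ is the space of bounded linear operators with the operator norm, $\mathcal{L}(X)=\mathcal{L}(X,X)$; $X^*$ is the dual space; $\operatorname{ext}(C)$ is the set of extreme points of $C$; $\operatorname{aco}$ denotes absolutely convex hull. $X$ is strictly convex if $\operatorname{ext}(B_X)=S_X$. $\operatorname{NA}(X)$: functionals $x^*\in X^*$ with $|x^*(x)|=\|x^*\|$ for some $x\in B_X$. $\operatorname{smo}(X^* )$: points of $X^*$ at which the norm of $X^*$ is G\^ateaux differentiable. $\operatorname{SE}(B_X)$: the $x^*\in X^*\setminus\{0\}$ for which there is $x_0\in B_X$ with $\operatorname{Re}x^*(x_0)=\sup_{x\in B_X}\operatorname{Re}x^*(x)$ and such that $x_n\to x_0$ in norm for every sequence $(x_n)\subseteq B_X$ with $\operatorname{Re}x^*(x_n)\to \operatorname{Re}x^*(x_0)$. $T\in\operatorname{ASE}(X,Y)$ (absolutely strongly exposing): there exists $x_0\in S_X$ such that whenever $(x_n)\subseteq B_X$ satisfies $\|Tx_n\|\to\|T\|$, there are a subsequence $(x_{\sigma(n)})$ and $\theta\in\mathbb{T}$ with $x_{\sigma(n)}\to\theta x_0$ in norm. A set $\Gamma\subseteq B_{Y^*}$ is $1$-norming if $\|y\|=\sup_{y^*\in\Gamma}|y^*(y)|$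 for all $y\in Y$. A function $f$ from a topological space $\mathcal{T}$ to a metric space is openly fragmented if for every nonempty open $U\subseteq\mathcal{T}$ and $\varepsilon>0$ there is a nonempty open $V\subseteq U$ with $\operatorname{diam}f(V)<\varepsilon$. For $\Gamma\subseteq Y^*$, $T\in\mathcal{L}(X,Y)$ is $\Gamma$-flat if the restriction $T^*|_\Gamma\colon(\Gamma,w^* )\to X^*$ (norm metric on $X^*$) is openly fragmented. A Banach space $Y$ has quasi-$\operatorname{ACK}$ structure (with $\Gamma$ and $\rho$) if there exist a $1$-norming set $\Gamma\subseteq B_{Y^*}$ and a function $\rho\colon\Gamma\to[0,1)$ such that for any $e^*\in\operatorname{ext}(B_{Y^*})$ there exists $\Gamma_{e^*}\subseteq\Gamma$ satisfying: (i) $e^*\in\overline{\mathbb{T}\Gamma_{e^*}}^{w^*}$; (ii) $\sup_{y^*\in\Gamma_{e^*}}\rho(y^* )<1$; (iii) for every $\varepsilon>0$ and every nonempty relatively $w^*$-open subset $U$ of $\Gamma_{e^*}$ there are a nonempty subset $V\subseteq U$, $y_1^*\in V$, $e\in S_Y$ and $F\in\mathcal{L}(Y)$ such that: (i') $\|F(e)\|=\|F\|=1$; (ii') $y_1^*(F(e))=1$; (iii') $F^*(y_1^* )=y_1^*$; (iv') letting $V_1:=\{y^*\in\Gamma\colon\|F^*(y^* )\|+(1-\varepsilon)\|y^*-F^*(y^* )\|\le1\}$, one has $|y^*(F(e))|\le\rho(y_1^* )$ for all $y^*\in\Gamma\setminus V_1$; (v') $\operatorname{dist}(F^*(y^* ),\operatorname{aco}\{0,V\})<\varepsilon$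 for all $y^*\in\Gamma$, where $\operatorname{aco}\{0,V\}$ is the absolutely convex hull of $\{0\}\cup V$; (vi') $|v^*(e)-1|\le\varepsilon$ for all $v^*\in V$.
   Formalization: The parenthetical "in particular, if X is strictly convex" in (b) is dropped because it is false (a strictly convex renorming of L_1[0,1] has smo(X* )∩NA(X) empty); (b) is stated only under density of smo(X* )∩NA(X) in X*. *)

theory Defs
  imports "HOL-Analysis.Analysis"
begin

text \<open>
  A scalar field that is a copy of the real or of the complex numbers: \<open>to_complex\<close> is an
  isometric field embedding (of real algebras) into the complex numbers whose image is
  one of the two.
\<close>

class real_or_complex = real_normed_field +
  fixes to_complex :: "'a \<Rightarrow> complex"
  assumes to_complex_add: "to_complex (x + y) = to_complex x + to_complex y"
    and to_complex_mult: "to_complex (x * y) = to_complex x * to_complex y"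
    and to_complex_scaleR: "to_complex (r *\<^sub>R x) = r *\<^sub>R to_complex x"
    and norm_to_complex: "norm (to_complex x) = norm x"
    and range_to_complex: "range to_complex = \<real> \<or> range to_complex = UNIV"

instantiation real :: real_or_complex
begin

definition "to_complex_real = complex_of_real"

instance
  by standard (auto simp: to_complex_real_def scaleR_conv_of_real Reals_def)

end

instantiation complex :: real_or_complex
begin

definition "to_complex_complex = (\<lambda>z::complex. z)"

instance
  by standard (auto simp: to_complex_complex_def)

end

text \<open>
  A nonzero Banach space over \<open>'k\<close>. The type supplies the norm and the underlying real space;
  the scalar multiplication of \<open>'k\<close> is a parameter that extends the one by reals.
\<close>

locale K_banach = vector_space scale
  for scale :: "'k::real_or_complex \<Rightarrow> 'x::banach \<Rightarrow> 'x" +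
  assumes norm_scale: "norm (scale a x) = norm a * norm x"
    and scale_of_real: "scale (of_real r) x = r *\<^sub>R x"
    and nonzero: "\<exists>x::'x. x \<noteq> 0"

text \<open>
  The type of bounded linear functions contains the real-linear ones. The \<open>'k\<close>-linear ones form
  a closed subspace, on which the norm of the type is the operator norm.
\<close>

definition K_operators ::
  "('k::real_or_complex \<Rightarrow> 'x::banach \<Rightarrow> 'x) \<Rightarrow> ('k \<Rightarrow> 'y::banach \<Rightarrow> 'y) \<Rightarrow> ('x \<Rightarrow>\<^sub>L 'y) set"
  where "K_operators sX sY = {T. \<forall>a x. blinfun_apply T (sX a x) = sY a (blinfun_apply T x)}"

definition dual :: "('k::real_or_complex \<Rightarrow> 'x::banach \<Rightarrow> 'x) \<Rightarrow> ('x \<Rightarrow>\<^sub>L 'k) set"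
  where "dual s = {f. \<forall>a x. blinfun_apply f (s a x) = a * blinfun_apply f x}"

definition dual_ball :: "('k::real_or_complex \<Rightarrow> 'x::banach \<Rightarrow> 'x) \<Rightarrow> ('x \<Rightarrow>\<^sub>L 'k) set"
  where "dual_ball s = {f \<in> dual s. norm f \<le> 1}"

definition scale_functional :: "'k::real_or_complex \<Rightarrow> ('x::banach \<Rightarrow>\<^sub>L 'k) \<Rightarrow> ('x \<Rightarrow>\<^sub>L 'k)"
  where "scale_functional a f = blinfun_mult_right a o\<^sub>L f"

definition adjoint_op :: "('x::banach \<Rightarrow>\<^sub>L 'y::banach) \<Rightarrow> ('y \<Rightarrow>\<^sub>L 'k::real_or_complex) \<Rightarrow> ('x \<Rightarrow>\<^sub>L 'k)"
  where "adjoint_op T f = f o\<^sub>L T"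

text \<open>
  For functionals the strong operator topology is the topology of pointwise convergence.
\<close>

definition weak_star :: "('k::real_or_complex \<Rightarrow> 'x::banach \<Rightarrow> 'x) \<Rightarrow> ('x \<Rightarrow>\<^sub>L 'k) topology"
  where "weak_star s = subtopology strong_operator_topology (dual s)"

definition NA :: "('k::real_or_complex \<Rightarrow> 'x::banach \<Rightarrow> 'x) \<Rightarrow> ('x \<Rightarrow>\<^sub>L 'k) set"
  where "NA s = {f \<in> dual s. \<exists>x. norm x \<le> 1 \<and> norm (blinfun_apply f x) = norm f}"

text \<open>
  The Gateaux derivative \<open>D\<close> is real-linear and bounded on the dual; the increment \<open>t\<close> is real.
\<close>

definition smo_dual :: "('k::real_or_complex \<Rightarrow> 'x::banach \<Rightarrow> 'x) \<Rightarrow> ('x \<Rightarrow>\<^sub>L 'k) set"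
  where "smo_dual s = {f \<in> dual s. \<exists>D :: ('x \<Rightarrow>\<^sub>L 'k) \<Rightarrow> real.
     (\<forall>g \<in> dual s. \<forall>h \<in> dual s. D (g + h) = D g + D h) \<and>
     (\<forall>g \<in> dual s. \<forall>r. D (r *\<^sub>R g) = r * D g) \<and>
     (\<exists>C. \<forall>g \<in> dual s. \<bar>D g\<bar> \<le> C * norm g) \<and>
     (\<forall>h \<in> dual s. ((\<lambda>t::real. (norm (f + t *\<^sub>R h) - norm f) / t) \<longlongrightarrow> D h) (at 0))}"

definition SE :: "('k::real_or_complex \<Rightarrow> 'x::banach \<Rightarrow> 'x) \<Rightarrow> ('x \<Rightarrow>\<^sub>L 'k) set"
  where "SE s = {f \<in> dual s. f \<noteq> 0 \<and> (\<exists>x0 \<in> cball 0 1.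
     Re (to_complex (blinfun_apply f x0)) = (SUP x \<in> cball 0 1. Re (to_complex (blinfun_apply f x))) \<and>
     (\<forall>xs. (\<forall>n::nat. xs n \<in> cball 0 1) \<and>
        (\<lambda>n. Re (to_complex (blinfun_apply f (xs n)))) \<longlonglongrightarrow> Re (to_complex (blinfun_apply f x0))
        \<longrightarrow> xs \<longlonglongrightarrow> x0))}"

definition ASE ::
  "('k::real_or_complex \<Rightarrow> 'x::banach \<Rightarrow> 'x) \<Rightarrow> ('k \<Rightarrow> 'y::banach \<Rightarrow> 'y) \<Rightarrow> ('x \<Rightarrow>\<^sub>L 'y) set"
  where "ASE sX sY = {T \<in> K_operators sX sY. \<exists>x0 \<in> sphere 0 1.
     \<forall>xs. (\<forall>n::nat. xs n \<in> cball 0 1) \<and> (\<lambda>n. norm (blinfun_apply T (xs n))) \<longlonglongrightarrow> norm T \<longrightarrow>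
       (\<exists>\<sigma> \<theta>. strict_mono \<sigma> \<and> norm \<theta> = 1 \<and> (xs \<circ> \<sigma>) \<longlonglongrightarrow> sX \<theta> x0)}"

definition one_norming :: "('k::real_or_complex \<Rightarrow> 'y::banach \<Rightarrow> 'y) \<Rightarrow> ('y \<Rightarrow>\<^sub>L 'k) set \<Rightarrow> bool"
  where "one_norming s \<Gamma> \<longleftrightarrow>
    \<Gamma> \<subseteq> dual_ball s \<and> (\<forall>y. norm y = (SUP f \<in> \<Gamma>. norm (blinfun_apply f y)))"

text \<open>
  \<open>diameter\<close> is a real number and is meaningless on unbounded sets, hence \<open>bounded\<close>.
\<close>

definition openly_fragmented :: "'a topology \<Rightarrow> ('a \<Rightarrow> 'b::metric_space) \<Rightarrow> bool"
  where "openly_fragmented \<T> f \<longleftrightarrow>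
    (\<forall>U \<epsilon>. openin \<T> U \<and> U \<noteq> {} \<and> 0 < \<epsilon> \<longrightarrow>
      (\<exists>V \<subseteq> U. openin \<T> V \<and> V \<noteq> {} \<and> bounded (f ` V) \<and> diameter (f ` V) < \<epsilon>))"

definition flat_operator ::
  "('k::real_or_complex \<Rightarrow> 'y::banach \<Rightarrow> 'y) \<Rightarrow> ('y \<Rightarrow>\<^sub>L 'k) set \<Rightarrow> ('x::banach \<Rightarrow>\<^sub>L 'y) \<Rightarrow> bool"
  where "flat_operator sY \<Gamma> T \<longleftrightarrow>
    openly_fragmented (subtopology (weak_star sY) \<Gamma>) (adjoint_op T)"

definition absolutely_convex :: "('x::banach \<Rightarrow>\<^sub>L 'k::real_or_complex) set \<Rightarrow> bool"
  where "absolutely_convex S \<longleftrightarrow> (\<forall>f \<in> S. \<forall>g \<in> S. \<forall>a b. norm a + norm b \<le> 1 \<longrightarrow>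
    scale_functional a f + scale_functional b g \<in> S)"

text \<open>
  \<open>infdist\<close> and \<open>SUP\<close> are only informative on nonempty sets. The hull contains \<open>0\<close>; \<open>\<Gamma>\<close> is nonempty
  because the space is nonzero, and \<open>\<Gamma>'\<close> in \<open>quasi_ACK\<close> because of the closure condition.
\<close>

definition quasi_ACK_witness ::
  "('k::real_or_complex \<Rightarrow> 'y::banach \<Rightarrow> 'y) \<Rightarrow> ('y \<Rightarrow>\<^sub>L 'k) set \<Rightarrow> (('y \<Rightarrow>\<^sub>L 'k) \<Rightarrow> real) \<Rightarrow> real \<Rightarrow>
    ('y \<Rightarrow>\<^sub>L 'k) set \<Rightarrow> ('y \<Rightarrow>\<^sub>L 'k) \<Rightarrow> 'y \<Rightarrow> ('y \<Rightarrow>\<^sub>L 'y) \<Rightarrow> bool"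
  where "quasi_ACK_witness s \<Gamma> \<rho> \<epsilon> V y1 e F \<longleftrightarrow>
    norm (blinfun_apply F e) = 1 \<and> norm F = 1 \<and>
    blinfun_apply y1 (blinfun_apply F e) = 1 \<and>
    adjoint_op F y1 = y1 \<and>
    (let V1 = {f \<in> \<Gamma>. norm (adjoint_op F f) + (1 - \<epsilon>) * norm (f - adjoint_op F f) \<le> 1}
     in \<forall>f \<in> \<Gamma> - V1. norm (blinfun_apply f (blinfun_apply F e)) \<le> \<rho> y1) \<and>
    (\<forall>f \<in> \<Gamma>. infdist (adjoint_op F f) (absolutely_convex hull ({0} \<union> V)) < \<epsilon>) \<and>
    (\<forall>f \<in> V. norm (blinfun_apply f e - 1) \<le> \<epsilon>)"

definition quasi_ACK ::
  "('k::real_or_complex \<Rightarrow> 'y::banach \<Rightarrow> 'y) \<Rightarrow> ('y \<Rightarrow>\<^sub>L 'k) set \<Rightarrow> (('y \<Rightarrow>\<^sub>L 'k) \<Rightarrow> real) \<Rightarrow> bool"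
  where "quasi_ACK s \<Gamma> \<rho> \<longleftrightarrow>
    one_norming s \<Gamma> \<and> (\<forall>f \<in> \<Gamma>. 0 \<le> \<rho> f \<and> \<rho> f < 1) \<and>
    (\<forall>e'. e' extreme_point_of dual_ball s \<longrightarrow>
      (\<exists>\<Gamma>'. \<Gamma>' \<subseteq> \<Gamma> \<and>
        e' \<in> weak_star s closure_of {scale_functional \<theta> f | \<theta> f. norm \<theta> = 1 \<and> f \<in> \<Gamma>'} \<and>
        (SUP f \<in> \<Gamma>'. \<rho> f) < 1 \<and>
        (\<forall>\<epsilon>>0. \<forall>U. openin (subtopology (weak_star s) \<Gamma>') U \<and> U \<noteq> {} \<longrightarrow>
          (\<exists>V y1 e F. V \<subseteq> U \<and> V \<noteq> {} \<and> y1 \<in> V \<and> e \<in> sphere 0 1 \<and> F \<in> K_operators s s \<and>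
            quasi_ACK_witness s \<Gamma> \<rho> \<epsilon> V y1 e F))))"

end

theory Submission
  imports Defs
begin

text \<open>
  The operator \<open>R\<close> is built from one functional \<open>f\<close> on \<open>X\<close> in the dense class, in such a way that
  \<open>norm R = norm f\<close>, that \<open>R\<close> dominates \<open>f\<close> pointwise, and that \<open>norm (R x)\<close>, for \<open>x\<close> in the unit
  ball, can be close to \<open>norm R\<close> only if \<open>\<bar>f x\<bar>\<close> is close to \<open>norm f\<close>. Every maximizing sequence of \<open>R\<close> is then
  one of \<open>f\<close>, and after a rotation of its terms by scalars of modulus one, a subsequence of
  which converges, the exposing property of \<open>f\<close> gives norm convergence, and the differentiability
  of the dual norm at \<open>f\<close> gives weak convergence (\<open>SE_maximizer\<close>, \<open>smo_maximizing_sequence\<close>).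

  For the construction, let \<open>S\<close> be close to \<open>T\<close>, let \<open>y1\<close>, \<open>e\<close>, \<open>F\<close>, \<open>V\<close> come from the structure of
  \<open>Y\<close> for a small \<open>\<delta>\<close>, and let \<open>f\<close> be close to \<open>f1 = S\<^sup>* y1\<close>, where \<open>S\<^sup>* y\<close> denotes \<open>adjoint_op S y\<close>.
  Put \<open>R x = f(x) F(e) + (1 - \<eta>)(S x - F(S x))\<close>. Then \<open>R\<^sup>* y1 = f\<close>, so that \<open>norm R \<ge> norm f\<close>, and
  the reverse inequality is checked on the norming set \<open>\<Gamma>\<close>. Flatness makes \<open>S\<^sup>*\<close> almost
  constant on \<open>V\<close>, and since \<open>F\<^sup>* y\<close> lies near the absolutely convex hull of \<open>V\<close>, the functional
  \<open>S\<^sup>* (F\<^sup>* y)\<close> is nearly \<open>y(F e) f1\<close>. Hence \<open>R\<close> is close to \<open>S\<close>. On the part \<open>V1\<close> of \<open>\<Gamma>\<close> the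
  inequality \<open>norm (F\<^sup>* y) + (1 - \<delta>) norm (y - F\<^sup>* y) \<le> 1\<close> bounds \<open>norm (R\<^sup>* y)\<close>; off \<open>V1\<close> the bound
  \<open>\<bar>y(F e)\<bar> \<le> \<rho> y1 < 1\<close> leaves a gain of order \<open>\<eta> (1 - \<rho> y1)\<close>, which must exceed the defect
  \<open>norm S - norm f1\<close> (\<open>modified_operator_estimates\<close>).

  Here is the difficulty: the bound for \<open>\<rho>\<close> depends on the extreme point \<open>e'\<close> of the dual ball, so
  the defect has to be made small after \<open>e'\<close> has been chosen. The remedy is to replace \<open>T\<close> by an
  operator \<open>S\<close> whose adjoint attains its norm exactly at an extreme point
  (\<open>adjoint_attains_norm_at_extreme_point\<close>). It arises from an iteration of
  Lindenstrauss type with rank-one perturbations. The points where the adjoints almost attain their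
  norms lie in decreasing slices of the dual ball, which shrink so fast that their intersection is
  a weak-star closed face; such a face contains an extreme point by compactness and
  Zorn's lemma. Rank-one perturbations and norm limits preserve flatness, and so \<open>S\<close> is still flat
  on the subsets of \<open>\<Gamma>\<close>.
\<close>

section \<open>The scalar field\<close>

text \<open>The embedding identifies the scalars with a closed subfield of the complex numbers; all that
  is needed are real parts, phases, and compactness of discs.\<close>

abbreviation re :: "'k::real_or_complex \<Rightarrow> real" where "re a \<equiv> Re (to_complex a)"

lemma to_complex_zero: "to_complex 0 = 0"
  by (metis norm_eq_zero norm_to_complex)

lemma to_complex_one: "to_complex 1 = 1"
  by (metis mult_cancel_right1 norm_eq_zero norm_one norm_to_complex to_complex_mult zero_neq_one)

lemma to_complex_of_real: "to_complex (of_real r) = of_real r"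
  by (simp add: of_real_def to_complex_scaleR to_complex_one)

lemma to_complex_diff: "to_complex (x - y) = to_complex x - to_complex y"
  by (metis add_diff_cancel_right' diff_add_cancel to_complex_add)

lemma re_scaleR: "re (r *\<^sub>R a) = r * re a"
  by (simp add: to_complex_scaleR)

lemma re_le_norm: "re a \<le> norm a"
  by (metis complex_Re_le_cmod norm_to_complex)

lemma re_of_real: "re (of_real r) = r"
  by (simp add: to_complex_of_real)

lemma continuous_on_to_complex: "continuous_on A to_complex"
  by (metis continuous_on_iff dist_norm norm_to_complex to_complex_diff)

lemma continuous_on_re: "continuous_on A re"
  by (intro continuous_intros continuous_on_to_complex)

lemma exists_phase:
  fixes a :: "'k::real_or_complex"
  shows "\<exists>\<theta>. norm \<theta> = 1 \<and> \<theta> * a = of_real (norm a)"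
proof (cases "a = 0")
  case False
  then show ?thesis
    by (intro exI[of _ "of_real (norm a) / a"]) (simp add: norm_divide)
qed (auto intro: exI[of _ 1])

lemma compact_cball_scalar: "compact (cball (0::'k::real_or_complex) r)"
proof -
  define g where "g = inv (to_complex :: 'k \<Rightarrow> complex)"
  have inj: "inj (to_complex :: 'k \<Rightarrow> complex)"
    by (metis injI eq_iff_diff_eq_0 norm_eq_zero norm_to_complex to_complex_diff)
  have g: "g (to_complex a) = a" for a
    unfolding g_def using inj by simp
  have "closed (range (to_complex :: 'k \<Rightarrow> complex))"
    using range_to_complex[where 'a = 'k] by (metis closed_UNIV closed_complex_Reals)
  then have "compact (cball 0 r \<inter> range (to_complex :: 'k \<Rightarrow> complex))"
    by (simp add: closed_Int_compact Int_commute compact_Int_closed)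
  moreover have "continuous_on (range (to_complex :: 'k \<Rightarrow> complex)) g"
    unfolding continuous_on_iff
    by (metis (no_types, lifting) dist_norm g norm_to_complex rangeE to_complex_diff)
  then have "continuous_on (cball 0 r \<inter> range (to_complex :: 'k \<Rightarrow> complex)) g"
    by (rule continuous_on_subset) auto
  ultimately have "compact (g ` (cball 0 r \<inter> range (to_complex :: 'k \<Rightarrow> complex)))"
    by (metis compact_continuous_image)
  moreover have "g ` (cball 0 r \<inter> range (to_complex :: 'k \<Rightarrow> complex)) = cball 0 r"
    by (force simp: g norm_to_complex image_iff)
  ultimately show ?thesis by simp
qed

lemma phase_subsequence:
  fixes \<theta> :: "nat \<Rightarrow> 'k::real_or_complex"
  assumes "\<And>n. norm (\<theta> n) = 1"
  shows "\<exists>\<sigma> l. strict_mono \<sigma> \<and> norm l = 1 \<and> (\<lambda>n. \<theta> (\<sigma> n)) \<longlonglongrightarrow> l"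
proof -
  have "seq_compact (cball (0::'k) 1)"
    using compact_cball_scalar compact_imp_seq_compact by blast
  then obtain l \<sigma> where l: "strict_mono \<sigma>" "(\<theta> \<circ> \<sigma>) \<longlonglongrightarrow> l"
    using assms unfolding seq_compact_def by (metis dist_0_norm mem_cball order_refl)
  then have "(\<lambda>n. norm ((\<theta> \<circ> \<sigma>) n)) \<longlonglongrightarrow> norm l"
    by (intro tendsto_norm)
  then have "norm l = 1"
    using assms by (simp add: LIMSEQ_const_iff)
  then show ?thesis
    using l by (auto simp: o_def)
qed

section \<open>The dual ball in the weak-star topology\<close>

lemma continuous_map_weak_star: "continuous_map (weak_star s) euclidean (\<lambda>f. blinfun_apply f x)"
  unfolding weak_star_def
  by (intro continuous_map_from_subtopology strong_operator_topology_continuous_evaluation)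

lemma topspace_weak_star: "topspace (weak_star s) = dual s"
  by (simp add: weak_star_def strong_operator_topology_topspace)

lemma continuous_map_weak_star_comp:
  assumes "continuous_on UNIV g"
  shows "continuous_map (weak_star s) euclidean (\<lambda>f. g (blinfun_apply f x))"
proof -
  have "continuous_map (weak_star s) euclidean (g \<circ> (\<lambda>f. blinfun_apply f x))"
    by (rule continuous_map_compose[OF continuous_map_weak_star]) (use assms in auto)
  then show ?thesis by (simp add: o_def)
qed

context K_banach
begin

lemma apply_dual_scale: "f \<in> dual scale \<Longrightarrow> blinfun_apply f (scale a x) = a * blinfun_apply f x"
  by (simp add: dual_def)

text \<open>The theorem of Banach and Alaoglu. The functionals of norm at most one form a closed subset of
  a product of discs, which is compact by Tychonoff's theorem; passing from functions to bounded
  linear maps is continuous because both topologies are those of pointwise convergence.\<close>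

lemma compactin_dual_ball: "compactin (weak_star scale) (dual_ball scale)"
proof -
  define P where "P = PiE UNIV (\<lambda>x::'x. cball (0::'k) (norm x))"
  define K where "K = {g \<in> P. (\<forall>x y. g (x + y) = g x + g y) \<and> (\<forall>a x. g (scale a x) = a * g x)}"
  have "compact P"
    unfolding P_def
    by (metis compactin_PiE compactin_euclidean_iff euclidean_product_topology compact_cball_scalar)
  moreover have "closed {g::'x \<Rightarrow> 'k. (\<forall>x y. g (x + y) = g x + g y) \<and> (\<forall>a x. g (scale a x) = a * g x)}"
    by (intro closed_Collect_conj closed_Collect_all closed_Collect_eq continuous_intros
        continuous_on_product_coordinates)
  ultimately have "compact K"
    unfolding K_def by (simp add: Collect_conj_eq compact_Int_closed)
  have bl: "bounded_linear g" if "g \<in> K" for g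
  proof (rule bounded_linear_intro[of _ 1])
    show "g (r *\<^sub>R x) = r *\<^sub>R g x" for r x
      using that scale_of_real[of r x] by (metis (mono_tags, lifting) K_def mem_Collect_eq scaleR_conv_of_real)
  qed (use that in \<open>auto simp: K_def P_def PiE_def\<close>)
  have ap: "blinfun_apply (Blinfun g) = g" if "g \<in> K" for g
    using bl[OF that] by (rule bounded_linear_Blinfun_apply)
  have cont: "continuous_map (top_of_set K) strong_operator_topology Blinfun"
    unfolding continuous_on_strong_operator_topo_iff_coordinatewise
  proof
    fix x
    have "continuous_on K (\<lambda>g. g x)"
      by (rule continuous_on_subset[OF continuous_on_product_coordinates]) auto
    then have "continuous_on K (\<lambda>g. blinfun_apply (Blinfun g) x)"
      by (simp add: ap cong: continuous_on_cong)
    then show "continuous_map (top_of_set K) euclidean (\<lambda>g. blinfun_apply (Blinfun g) x)"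
      by simp
  qed
  have "compactin strong_operator_topology (Blinfun ` K)"
    by (rule image_compactin[OF _ cont]) (use \<open>compact K\<close> in \<open>simp add: compactin_subtopology\<close>)
  moreover have "Blinfun ` K = dual_ball scale"
  proof
    show "Blinfun ` K \<subseteq> dual_ball scale"
    proof safe
      fix g assume g: "g \<in> K"
      have "norm (Blinfun g) \<le> 1"
        by (rule norm_blinfun_bound) (use g in \<open>auto simp: ap K_def P_def PiE_def\<close>)
      then show "Blinfun g \<in> dual_ball scale"
        using g by (auto simp: dual_ball_def dual_def ap) (simp add: K_def)
    qed
    show "dual_ball scale \<subseteq> Blinfun ` K"
    proof
      fix f assume f: "f \<in> dual_ball scale"
      have "norm (blinfun_apply f x) \<le> norm x" for x
        by (metis (no_types, lifting) f dual_ball_def mem_Collect_eq mult_left_le_one_le norm_blinfun norm_ge_zero order_trans)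
      then have "blinfun_apply f \<in> K"
        using f by (auto simp: K_def P_def dual_ball_def dual_def blinfun.add_right)
      then show "f \<in> Blinfun ` K"
        by (metis blinfun_apply_inverse image_eqI)
    qed
  qed
  ultimately show ?thesis
    unfolding weak_star_def compactin_subtopology by (auto simp: dual_ball_def)
qed

lemma closedin_dual_ball: "closedin (weak_star scale) (dual_ball scale)"
proof -
  have "dual_ball scale = {f \<in> topspace (weak_star scale). \<forall>x. norm (blinfun_apply f x) \<le> norm x}"
    unfolding topspace_weak_star dual_ball_def
    by (auto intro: norm_blinfun_bound)
      (metis mult_left_le_one_le norm_blinfun norm_ge_zero order_trans)
  also have "\<dots> = (\<Inter>x. {f \<in> topspace (weak_star scale). norm (blinfun_apply f x) \<in> {..norm x}})"
    by auto
  also have "closedin (weak_star scale) \<dots>"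
    by (intro closedin_INT closedin_continuous_map_preimage[OF continuous_map_weak_star_comp])
      (auto intro: continuous_intros)
  finally show ?thesis .
qed

lemma closedin_dual_ball_slice:
  "closedin (weak_star scale) {f \<in> dual_ball scale. c \<le> re (blinfun_apply f x)}"
proof -
  have "closedin (weak_star scale) {f \<in> topspace (weak_star scale). re (blinfun_apply f x) \<in> {c..}}"
    by (intro closedin_continuous_map_preimage[OF continuous_map_weak_star_comp])
      (auto intro: continuous_on_re)
  then have "closedin (weak_star scale)
     (dual_ball scale \<inter> {f \<in> topspace (weak_star scale). re (blinfun_apply f x) \<in> {c..}})"
    by (intro closedin_Int closedin_dual_ball)
  also have "dual_ball scale \<inter> {f \<in> topspace (weak_star scale). re (blinfun_apply f x) \<in> {c..}}
     = {f \<in> dual_ball scale. c \<le> re (blinfun_apply f x)}"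
    by (auto simp: topspace_weak_star dual_ball_def)
  finally show ?thesis .
qed

lemma re_attains_max:
  assumes "closedin (weak_star scale) M" "M \<subseteq> dual_ball scale" "M \<noteq> {}"
  shows "\<exists>f\<in>M. \<forall>g\<in>M. re (blinfun_apply g x) \<le> re (blinfun_apply f x)"
proof -
  have "compactin (weak_star scale) M"
    using assms compactin_dual_ball closed_compactin by blast
  then have "compactin euclidean ((\<lambda>f. re (blinfun_apply f x)) ` M)"
    by (rule image_compactin) (intro continuous_map_weak_star_comp continuous_on_re)
  then have "compact ((\<lambda>f. re (blinfun_apply f x)) ` M)"
    by simp
  then show ?thesis
    using compact_attains_sup[of "(\<lambda>f. re (blinfun_apply f x)) ` M"] assms by auto
qed

lemma Inter_chain_closed_nonempty:
  assumes C: "\<And>M. M \<in> C \<Longrightarrow> closedin (weak_star scale) M \<and> M \<subseteq> dual_ball scale \<and> M \<noteq> {}"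
    and chain: "\<And>M N. M \<in> C \<Longrightarrow> N \<in> C \<Longrightarrow> M \<subseteq> N \<or> N \<subseteq> M" and "C \<noteq> {}"
  shows "\<Inter>C \<noteq> {}"
proof -
  have "dual_ball scale \<inter> \<Inter>\<F> \<noteq> {}" if "finite \<F>" "\<F> \<subseteq> C" for \<F>
  proof (cases "\<F> = {}")
    case True
    then show ?thesis using C \<open>C \<noteq> {}\<close> by fastforce
  next
    case False
    have "subset.chain C \<F>"
      using that chain by (auto simp: subset_chain_def)
    then have "\<Inter>\<F> \<in> \<F>"
      using Inter_in_chain that False by blast
    then show ?thesis
      using that C by blast
  qed
  then have "dual_ball scale \<inter> \<Inter>C \<noteq> {}"
    using compactin_dual_ball[unfolded compactin_fip, THEN conjunct2, rule_format, of C] C by simp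
  then show ?thesis by blast
qed

text \<open>A minimal closed face is a singleton, since the evaluations separate functionals and each of
  them attains its maximum on a smaller closed face.\<close>

lemma extreme_point_in_closed_face:
  assumes F: "closedin (weak_star scale) F" "F face_of dual_ball scale" "F \<noteq> {}"
  shows "\<exists>e\<in>F. e extreme_point_of dual_ball scale"
proof -
  define \<A> where "\<A> = {M. closedin (weak_star scale) M \<and> M face_of dual_ball scale \<and> M \<noteq> {} \<and> M \<subseteq> F}"
  have "\<exists>M\<in>\<A>. \<forall>N\<in>\<A>. N \<subseteq> M \<longrightarrow> N = M"
  proof (rule predicate_Zorn)
    show "partial_order_on \<A> (relation_of (\<lambda>M N. N \<subseteq> M) \<A>)"
      by (rule partial_order_on_relation_ofI) auto
    fix C assume "C \<in> Chains (relation_of (\<lambda>M N. N \<subseteq> M) \<A>)"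
    then have C: "C \<subseteq> \<A>" "\<And>M N. M \<in> C \<Longrightarrow> N \<in> C \<Longrightarrow> M \<subseteq> N \<or> N \<subseteq> M"
      by (auto simp: Chains_def relation_of_def)
    show "\<exists>u\<in>\<A>. \<forall>a\<in>C. u \<subseteq> a"
    proof (cases "C = {}")
      case True
      then show ?thesis using F by (auto simp: \<A>_def)
    next
      case False
      have "\<Inter>C \<noteq> {}"
        by (rule Inter_chain_closed_nonempty[OF _ C(2) False])
          (use C(1) in \<open>auto simp: \<A>_def dest: face_of_imp_subset\<close>)
      moreover have "closedin (weak_star scale) (\<Inter>C)"
        using C(1) False by (intro closedin_Inter) (auto simp: \<A>_def)
      moreover have "\<Inter>C face_of dual_ball scale"
        using C(1) False by (intro face_of_Inter) (auto simp: \<A>_def)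
      moreover have "\<Inter>C \<subseteq> F"
        using C(1) False unfolding \<A>_def by blast
      ultimately have "\<Inter>C \<in> \<A>"
        by (simp add: \<A>_def)
      then show ?thesis by blast
    qed
  qed
  then obtain M where M: "M \<in> \<A>" and min: "\<And>N. N \<in> \<A> \<Longrightarrow> N \<subseteq> M \<Longrightarrow> N = M"
    by blast
  have Mb: "M \<subseteq> dual_ball scale"
    using M by (auto simp: \<A>_def dest: face_of_imp_subset)
  have "f = g" if f: "f \<in> M" and g: "g \<in> M" for f g
  proof (rule ccontr)
    assume "f \<noteq> g"
    then obtain x where x: "blinfun_apply f x \<noteq> blinfun_apply g x"
      by (metis blinfun_eqI)
    obtain \<theta> where \<theta>: "\<theta> * (blinfun_apply f x - blinfun_apply g x)
        = of_real (norm (blinfun_apply f x - blinfun_apply g x))"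
      using exists_phase by blast
    define z where "z = scale \<theta> x"
    have "blinfun_apply h z = \<theta> * blinfun_apply h x" if "h \<in> M" for h
      using that Mb by (auto simp: z_def dual_ball_def apply_dual_scale)
    then have "re (blinfun_apply f z - blinfun_apply g z) = norm (blinfun_apply f x - blinfun_apply g x)"
      using f g \<theta> by (metis re_of_real right_diff_distrib)
    then have gf: "re (blinfun_apply g z) < re (blinfun_apply f z)"
      using x by (smt (verit) to_complex_diff minus_complex.simps(1) right_minus_eq zero_less_norm_iff)
    \<comment> \<open>The evaluation at \<open>z\<close> separates \<open>f\<close> from \<open>g\<close>, so the face \<open>N\<close> on which it is maximal is proper.\<close>
    obtain h where h: "h \<in> M" "\<And>k. k \<in> M \<Longrightarrow> re (blinfun_apply k z) \<le> re (blinfun_apply h z)"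
      using re_attains_max[of M z] M Mb unfolding \<A>_def by blast
    define N where "N = {k \<in> M. re (blinfun_apply h z) \<le> re (blinfun_apply k z)}"
    have lin: "re (blinfun_apply ((1 - u) *\<^sub>R a + u *\<^sub>R b) z)
        = (1 - u) * re (blinfun_apply a z) + u * re (blinfun_apply b z)"
      for u and a b :: "'x \<Rightarrow>\<^sub>L 'k"
      by (simp add: blinfun.add_left blinfun.scaleR_left to_complex_add re_scaleR)
    have "N face_of M"
      unfolding face_of_def
    proof (intro conjI ballI impI)
      show "N \<subseteq> M" by (auto simp: N_def)
      have "convex M"
        using M by (auto simp: \<A>_def dest: face_of_imp_convex)
      then have comb: "(1 - u) *\<^sub>R a + u *\<^sub>R b \<in> M" if "a \<in> M" "b \<in> M" "0 \<le> u" "u \<le> 1" for a b u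
        using that by (simp add: convex_alt)
      have "re (blinfun_apply h z) \<le> (1 - u) * p + u * q"
        if "re (blinfun_apply h z) \<le> p" "re (blinfun_apply h z) \<le> q" "0 \<le> u" "u \<le> 1" for u p q :: real
        using convex_bound_le[of "- p" "- re (blinfun_apply h z)" "- q" "1 - u" u] that by simp
      then show "convex N"
        unfolding convex_alt N_def using comb by (simp add: lin)
    next
      fix a b k assume ab: "a \<in> M" "b \<in> M" "k \<in> N" "k \<in> open_segment a b"
      then obtain u where u: "0 < u" "u < 1" "k = (1 - u) *\<^sub>R a + u *\<^sub>R b"
        by (auto simp: in_segment)
      have *: "re (blinfun_apply a z) \<le> re (blinfun_apply h z)" "re (blinfun_apply b z) \<le> re (blinfun_apply h z)"
        using h ab by auto
      have le: "re (blinfun_apply h z) \<le> (1 - u) * re (blinfun_apply a z) + u * re (blinfun_apply b z)"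
        using ab(3) by (simp add: N_def u(3) lin)
      have "(1 - u) * (re (blinfun_apply h z) - re (blinfun_apply a z)) \<le> u * (re (blinfun_apply b z) - re (blinfun_apply h z))"
        using le by (simp add: algebra_simps)
      also have "\<dots> \<le> 0"
        using u * by (simp add: mult_nonneg_nonpos)
      finally have a: "re (blinfun_apply h z) \<le> re (blinfun_apply a z)"
        using u by (simp add: mult_le_0_iff)
      have "u * (re (blinfun_apply h z) - re (blinfun_apply b z)) \<le> (1 - u) * (re (blinfun_apply a z) - re (blinfun_apply h z))"
        using le by (simp add: algebra_simps)
      also have "\<dots> \<le> 0"
        using u * by (simp add: mult_nonneg_nonpos)
      finally have "re (blinfun_apply h z) \<le> re (blinfun_apply b z)"
        using u by (simp add: mult_le_0_iff)
      then show "a \<in> N" "b \<in> N"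
        using a ab by (auto simp: N_def)
    qed
    moreover have "closedin (weak_star scale) N"
    proof -
      have "N = M \<inter> {k \<in> dual_ball scale. re (blinfun_apply h z) \<le> re (blinfun_apply k z)}"
        using Mb by (auto simp: N_def)
      then show ?thesis
        using M closedin_dual_ball_slice by (auto simp: \<A>_def intro: closedin_Int)
    qed
    ultimately have "N \<in> \<A>"
      using M h unfolding \<A>_def by (auto simp: N_def intro: face_of_trans)
    then have "N = M"
      by (rule min) (auto simp: N_def)
    then have "re (blinfun_apply h z) \<le> re (blinfun_apply g z)"
      using g by (auto simp: N_def)
    then show False
      using gf h(2)[OF f] by linarith
  qed
  moreover obtain e where e: "e \<in> M"
    using M by (auto simp: \<A>_def)
  ultimately have "M = {e}" by blast
  then have "e extreme_point_of dual_ball scale"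
    using M by (metis (mono_tags, lifting) \<A>_def face_of_singleton mem_Collect_eq)
  then show ?thesis
    using e M by (auto simp: \<A>_def)
qed

end

section \<open>Rank-one operators and flatness\<close>

text \<open>The operator written \<open>f \<otimes> z\<close> in functional analysis.\<close>

definition rank_one ::
  "('k::real_or_complex \<Rightarrow> 'y::banach \<Rightarrow> 'y) \<Rightarrow> ('x::banach \<Rightarrow>\<^sub>L 'k) \<Rightarrow> 'y \<Rightarrow> ('x \<Rightarrow>\<^sub>L 'y)"
  where "rank_one s f z = Blinfun (\<lambda>x. s (blinfun_apply f x) z)"

lemma apply_adjoint: "blinfun_apply (adjoint_op T y) x = blinfun_apply y (blinfun_apply T x)"
  by (simp add: adjoint_op_def)

lemma adjoint_add: "adjoint_op (S + T) y = adjoint_op S y + adjoint_op T y"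
  by (intro blinfun_eqI) (simp add: apply_adjoint blinfun.add_left blinfun.add_right)

lemma adjoint_diff: "adjoint_op T (y - z) = adjoint_op T y - adjoint_op T z"
  by (intro blinfun_eqI) (simp add: apply_adjoint blinfun.diff_left)

lemma norm_adjoint_le: "norm (adjoint_op T y) \<le> norm T * norm y"
  unfolding adjoint_op_def by (metis mult.commute norm_blinfun_compose)

lemma norm_apply_le_ball:
  assumes "norm x \<le> 1"
  shows "norm (blinfun_apply T x) \<le> norm T"
  by (metis assms mult_left_le norm_blinfun norm_ge_zero order_trans)

lemma norm_dual_ball_apply_le:
  assumes "f \<in> dual_ball s"
  shows "norm (blinfun_apply f x) \<le> norm x"
  using assms norm_blinfun[of f x] mult_right_mono[of "norm f" 1 "norm x"]
  by (auto simp: dual_ball_def)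

lemma almost_norming_vector:
  fixes A :: "'x::real_normed_vector \<Rightarrow>\<^sub>L 'y::real_normed_vector"
  assumes "\<delta> > 0"
  shows "\<exists>x. norm x \<le> 1 \<and> norm A - \<delta> < norm (blinfun_apply A x)"
proof (cases "norm A < \<delta>")
  case True
  then show ?thesis by (intro exI[of _ 0]) simp
next
  case False
  have "\<exists>x. (norm A - \<delta>) * norm x < norm (blinfun_apply A x)"
  proof (rule ccontr)
    assume "\<not> ?thesis"
    then have "norm A \<le> norm A - \<delta>"
      using False by (intro norm_blinfun_bound) (auto simp: not_less)
    then show False using assms by simp
  qed
  then obtain x where x: "(norm A - \<delta>) * norm x < norm (blinfun_apply A x)" by blast
  then have "x \<noteq> 0" by auto
  then show ?thesis
    using x by (intro exI[of _ "x /\<^sub>R norm x"]) (simp add: blinfun.scaleR_right field_simps)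
qed

context K_banach
begin

lemma scale_scaleR: "scale a (r *\<^sub>R x) = r *\<^sub>R scale a x"
  by (metis scale_left_commute scale_of_real)

lemma scale_scaleR_left: "scale (r *\<^sub>R a) x = r *\<^sub>R scale a x"
  by (metis scale_of_real scale_scale scaleR_conv_of_real)

lemma rank_one_apply: "blinfun_apply (rank_one scale f z) x = scale (blinfun_apply f x) z"
proof -
  have "bounded_linear (\<lambda>x. scale (blinfun_apply f x) z)"
  proof (rule bounded_linear_intro[of _ "norm f * norm z"])
    show "norm (scale (blinfun_apply f x) z) \<le> norm x * (norm f * norm z)" for x
      using mult_right_mono[OF norm_blinfun[of f x], of "norm z"] by (simp add: norm_scale algebra_simps)
  qed (simp_all add: blinfun.add_right scale_left_distrib blinfun.scaleR_right scale_scaleR_left)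
  then show ?thesis
    by (simp add: rank_one_def bounded_linear_Blinfun_apply)
qed

lemma norm_rank_one_le: "norm (rank_one scale f z) \<le> norm f * norm z"
proof (rule norm_blinfun_bound)
  show "norm (blinfun_apply (rank_one scale f z) x) \<le> norm f * norm z * norm x" for x
    using mult_right_mono[OF norm_blinfun[of f x], of "norm z"]
    by (simp add: rank_one_apply norm_scale algebra_simps)
qed simp

lemma scale_functional_dual_ball:
  assumes "f \<in> dual_ball scale" "norm a \<le> 1"
  shows "scale_functional a f \<in> dual_ball scale"
proof -
  have "norm (scale_functional a f) \<le> 1"
  proof (rule norm_blinfun_bound)
    show "norm (blinfun_apply (scale_functional a f) x) \<le> 1 * norm x" for x
      using mult_mono[OF assms(2) norm_dual_ball_apply_le[OF assms(1)], of x]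
      by (simp add: scale_functional_def norm_mult)
  qed simp
  then show ?thesis
    using assms by (auto simp: dual_ball_def dual_def scale_functional_def)
qed

lemma one_norming_subset: "one_norming scale \<Gamma> \<Longrightarrow> \<Gamma> \<subseteq> dual_ball scale"
  by (simp add: one_norming_def)

lemma one_norming_nonempty:
  assumes "one_norming scale \<Gamma>"
  shows "\<Gamma> \<noteq> {}"
proof
  assume "\<Gamma> = {}"
  then have const: "norm x = Sup {}" for x :: 'x
    using conjunct2[OF assms[unfolded one_norming_def], rule_format, of x] \<open>\<Gamma> = {}\<close> by simp
  obtain x :: 'x where "x \<noteq> 0"
    using nonzero by blast
  then show False
    using const[of x] const[of 0] by simp
qed

lemma one_norming_witness:
  assumes "one_norming scale \<Gamma>" "t < norm z"
  shows "\<exists>f\<in>\<Gamma>. t < norm (blinfun_apply f z)"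
proof -
  have "bdd_above ((\<lambda>f. norm (blinfun_apply f z)) ` \<Gamma>)"
    using one_norming_subset[OF assms(1)] norm_dual_ball_apply_le by (intro bdd_aboveI2[of _ _ "norm z"]) blast
  moreover have "t < (SUP f \<in> \<Gamma>. norm (blinfun_apply f z))"
    using assms by (simp add: one_norming_def)
  ultimately show ?thesis
    using one_norming_nonempty[OF assms(1)] by (simp add: less_cSUP_iff)
qed

text \<open>Compactness of the dual ball turns the supremum over a norming set into a maximum, and a
  rotation makes the value real.\<close>

lemma norming_functional:
  assumes "one_norming scale \<Gamma>"
  shows "\<exists>e\<in>dual_ball scale. blinfun_apply e z = of_real (norm z)"
proof -
  have "dual_ball scale \<noteq> {}"
    using one_norming_nonempty[OF assms] one_norming_subset[OF assms] by blast
  then obtain f where f: "f \<in> dual_ball scale"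
      "\<And>g. g \<in> dual_ball scale \<Longrightarrow> re (blinfun_apply g z) \<le> re (blinfun_apply f z)"
    using re_attains_max[OF closedin_dual_ball order_refl] by blast
  have *: "norm (blinfun_apply g z) \<le> norm (blinfun_apply f z)" if "g \<in> \<Gamma>" for g
  proof -
    obtain \<theta> where \<theta>: "norm \<theta> = 1" "\<theta> * blinfun_apply g z = of_real (norm (blinfun_apply g z))"
      using exists_phase by blast
    have "g \<in> dual_ball scale" using that one_norming_subset[OF assms] by blast
    then have "re (blinfun_apply (scale_functional \<theta> g) z) \<le> re (blinfun_apply f z)"
      using \<theta>(1) by (intro f scale_functional_dual_ball) auto
    then show ?thesis
      using \<theta>(2) re_le_norm[of "blinfun_apply f z"]
      by (simp add: scale_functional_def re_of_real)
  qed
  have "norm z \<le> norm (blinfun_apply f z)"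
  proof (rule ccontr)
    assume "\<not> ?thesis"
    then obtain g where "g \<in> \<Gamma>" "norm (blinfun_apply f z) < norm (blinfun_apply g z)"
      using one_norming_witness[OF assms] by (meson not_le)
    then show False using * by fastforce
  qed
  then have eq: "norm (blinfun_apply f z) = norm z"
    using norm_dual_ball_apply_le[OF f(1)] by (simp add: antisym)
  obtain \<theta> where \<theta>: "norm \<theta> = 1" "\<theta> * blinfun_apply f z = of_real (norm (blinfun_apply f z))"
    using exists_phase by blast
  then have "blinfun_apply (scale_functional \<theta> f) z = of_real (norm z)"
    by (simp add: scale_functional_def eq)
  then show ?thesis
    using scale_functional_dual_ball[OF f(1)] \<theta>(1) by (metis order_refl)
qed

end

locale K_banach_pair = X: K_banach sX + Y: K_banach sY
  for sX :: "'k::real_or_complex \<Rightarrow> 'x::banach \<Rightarrow> 'x" and sY :: "'k \<Rightarrow> 'y::banach \<Rightarrow> 'y"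
begin

lemma K_operators_add:
  "S \<in> K_operators sX sY \<Longrightarrow> T \<in> K_operators sX sY \<Longrightarrow> S + T \<in> K_operators sX sY"
  by (simp add: K_operators_def blinfun.add_left Y.scale_right_distrib)

lemma K_operators_diff:
  "S \<in> K_operators sX sY \<Longrightarrow> T \<in> K_operators sX sY \<Longrightarrow> S - T \<in> K_operators sX sY"
  by (simp add: K_operators_def blinfun.diff_left Y.scale_right_diff_distrib)

lemma K_operators_scaleR: "S \<in> K_operators sX sY \<Longrightarrow> r *\<^sub>R S \<in> K_operators sX sY"
  by (simp add: K_operators_def blinfun.scaleR_left Y.scale_scaleR)

lemma K_operators_compose:
  "F \<in> K_operators sY sY \<Longrightarrow> S \<in> K_operators sX sY \<Longrightarrow> F o\<^sub>L S \<in> K_operators sX sY"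
  by (simp add: K_operators_def)

lemma K_operators_rank_one: "f \<in> dual sX \<Longrightarrow> rank_one sY f z \<in> K_operators sX sY"
  by (simp add: K_operators_def dual_def Y.rank_one_apply)

lemma adjoint_dual: "T \<in> K_operators sX sY \<Longrightarrow> y \<in> dual sY \<Longrightarrow> adjoint_op T y \<in> dual sX"
  by (simp add: K_operators_def dual_def apply_adjoint)

lemma dual_scaleR: "f \<in> dual sX \<Longrightarrow> r *\<^sub>R f \<in> dual sX"
  by (simp add: dual_def blinfun.scaleR_left)

lemma closed_K_operators: "closed (K_operators sX sY)"
proof -
  have eq: "K_operators sX sY = (\<Inter>a. \<Inter>x. {T. norm (blinfun_apply T (sX a x) - sY a (blinfun_apply T x)) = 0})"
    by (auto simp: K_operators_def)
  have "continuous_on UNIV (sY a)" for a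
  proof (rule linear_continuous_on, rule bounded_linear_intro[of _ "norm a"])
  qed (simp_all add: Y.scale_right_distrib Y.scale_scaleR Y.norm_scale mult.commute)
  then have *: "continuous_on UNIV (\<lambda>T. sY a (blinfun_apply T x))" for a and x :: 'x
    by (intro continuous_on_compose2[of UNIV "sY a" UNIV "\<lambda>T. blinfun_apply T x"] continuous_intros) auto
  show ?thesis
    unfolding eq
    by (intro closed_INT ballI closed_Collect_eq continuous_intros *)
qed

end

text \<open>Pairwise distances are easier to handle than the diameter, which carries a side condition of
  boundedness; halving \<open>\<epsilon>\<close> recovers the strict inequality for the diameter.\<close>

lemma openly_fragmented_iff:
  "openly_fragmented \<T> f \<longleftrightarrow>
    (\<forall>U \<epsilon>. openin \<T> U \<and> U \<noteq> {} \<and> 0 < \<epsilon> \<longrightarrow>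
      (\<exists>V \<subseteq> U. openin \<T> V \<and> V \<noteq> {} \<and> (\<forall>p\<in>V. \<forall>q\<in>V. dist (f p) (f q) < \<epsilon>)))"
  (is "?L \<longleftrightarrow> ?R")
proof
  assume ?L
  then show ?R
    unfolding openly_fragmented_def
    by (meson diameter_bounded_bound image_eqI le_less_trans)
next
  assume R: ?R
  show ?L
    unfolding openly_fragmented_def
  proof (intro allI impI)
    fix U and \<epsilon> :: real assume U: "openin \<T> U \<and> U \<noteq> {} \<and> 0 < \<epsilon>"
    then obtain V where V: "V \<subseteq> U" "openin \<T> V" "V \<noteq> {}" "\<forall>p\<in>V. \<forall>q\<in>V. dist (f p) (f q) < \<epsilon> / 2"
      using R[rule_format, of U "\<epsilon> / 2"] by auto
    then obtain p where p: "p \<in> V" by blast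
    have "bounded (f ` V)"
      unfolding bounded_def using V(4) p by (intro exI[of _ "f p"] exI[of _ "\<epsilon> / 2"]) (auto intro: less_imp_le)
    moreover have "diameter (f ` V) \<le> \<epsilon> / 2"
    proof -
      have "(SUP (x, y)\<in>f ` V \<times> f ` V. dist x y) \<le> \<epsilon> / 2"
      proof (rule cSUP_least)
        show "f ` V \<times> f ` V \<noteq> {}" using p by blast
        show "(case z of (x, y) \<Rightarrow> dist x y) \<le> \<epsilon> / 2" if "z \<in> f ` V \<times> f ` V" for z
          using that V(4) by (auto intro: less_imp_le)
      qed
      then show ?thesis
        using p by (auto simp: diameter_def)
    qed
    ultimately show "\<exists>V\<subseteq>U. openin \<T> V \<and> V \<noteq> {} \<and> bounded (f ` V) \<and> diameter (f ` V) < \<epsilon>"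
      using V U by (intro exI[of _ V]) auto
  qed
qed

lemma openin_weak_star_slice:
  assumes "openin (subtopology (weak_star s) \<Gamma>) U" "open W"
  shows "openin (subtopology (weak_star s) \<Gamma>) {y \<in> U. blinfun_apply y z \<in> W}"
proof -
  have "continuous_map (subtopology (weak_star s) \<Gamma>) euclidean (\<lambda>y. blinfun_apply y z)"
    by (intro continuous_map_from_subtopology continuous_map_weak_star)
  then have "openin (subtopology (weak_star s) \<Gamma>)
      {y \<in> topspace (subtopology (weak_star s) \<Gamma>). blinfun_apply y z \<in> W}"
    using assms(2) by (auto simp: continuous_map_def)
  then have "openin (subtopology (weak_star s) \<Gamma>)
      (U \<inter> {y \<in> topspace (subtopology (weak_star s) \<Gamma>). blinfun_apply y z \<in> W})"
    using assms(1) by blast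
  also have "U \<inter> {y \<in> topspace (subtopology (weak_star s) \<Gamma>). blinfun_apply y z \<in> W}
      = {y \<in> U. blinfun_apply y z \<in> W}"
    using openin_subset[OF assms(1)] by auto
  finally show ?thesis .
qed

context K_banach
begin

text \<open>The adjoint of a rank-one operator maps \<open>y\<close> to \<open>y(z) f\<close>. This is continuous from the weak-star
  to the norm topology, so its oscillation is small on a smaller open set.\<close>

lemma flat_operator_add_rank_one:
  assumes "flat_operator scale \<Gamma> A"
  shows "flat_operator scale \<Gamma> (A + rank_one scale f z)"
  unfolding flat_operator_def openly_fragmented_iff
proof (intro allI impI)
  fix U and \<epsilon> :: real
  let ?T = "subtopology (weak_star scale) \<Gamma>"
  assume U: "openin ?T U \<and> U \<noteq> {} \<and> 0 < \<epsilon>"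
  then obtain V where V: "V \<subseteq> U" "openin ?T V" "V \<noteq> {}"
      "\<forall>p\<in>V. \<forall>q\<in>V. dist (adjoint_op A p) (adjoint_op A q) < \<epsilon> / 2"
    using assms[unfolded flat_operator_def openly_fragmented_iff, rule_format, of U "\<epsilon> / 2"] by auto
  obtain y0 where y0: "y0 \<in> V" using V by auto
  define r where "r = \<epsilon> / (4 * (norm f + 1))"
  have r: "r > 0" using U by (simp add: r_def add_nonneg_pos)
  define W where "W = {y \<in> V. blinfun_apply y z \<in> ball (blinfun_apply y0 z) r}"
  have "openin ?T W"
    unfolding W_def by (intro openin_weak_star_slice V) simp
  moreover have "y0 \<in> W" using y0 r by (simp add: W_def)
  moreover have "dist (adjoint_op (A + rank_one scale f z) p) (adjoint_op (A + rank_one scale f z) q) < \<epsilon>"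
    if pq: "p \<in> W" "q \<in> W" for p q
  proof -
    have d: "p \<in> dual scale" "q \<in> dual scale"
      using pq openin_subset[OF V(2)] by (auto simp: W_def topspace_weak_star)
    have pqz: "norm (blinfun_apply p z - blinfun_apply q z) \<le> 2 * r"
      using pq norm_triangle_ineq4[of "blinfun_apply p z - blinfun_apply y0 z" "blinfun_apply q z - blinfun_apply y0 z"]
      by (simp add: W_def dist_norm norm_minus_commute)
    have "norm (adjoint_op (rank_one scale f z) (p - q)) \<le> norm f * (2 * r)"
    proof (rule norm_blinfun_bound)
      fix x
      have "blinfun_apply (adjoint_op (rank_one scale f z) (p - q)) x
          = blinfun_apply f x * (blinfun_apply p z - blinfun_apply q z)"
        using d by (simp add: apply_adjoint rank_one_apply blinfun.diff_left apply_dual_scale right_diff_distrib)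
      also have "norm \<dots> \<le> (norm f * norm x) * (2 * r)"
        unfolding norm_mult by (intro mult_mono norm_blinfun pqz) auto
      finally show "norm (blinfun_apply (adjoint_op (rank_one scale f z) (p - q)) x) \<le> norm f * (2 * r) * norm x"
        by (simp add: algebra_simps)
    qed (use r in auto)
    also have "\<dots> < (norm f + 1) * (2 * r)"
      using r by simp
    also have "(norm f + 1) * (2 * r) = \<epsilon> / 2"
      using norm_ge_zero[of f] by (simp add: r_def divide_simps) (smt (verit) norm_ge_zero)
    finally have "norm (adjoint_op (rank_one scale f z) p - adjoint_op (rank_one scale f z) q) < \<epsilon> / 2"
      by (simp add: adjoint_diff)
    moreover have "norm (adjoint_op A p - adjoint_op A q) < \<epsilon> / 2"
      using V(4) pq by (auto simp: W_def dist_norm)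
    ultimately show ?thesis
      using norm_triangle_ineq[of "adjoint_op A p - adjoint_op A q"
          "adjoint_op (rank_one scale f z) p - adjoint_op (rank_one scale f z) q"]
      by (simp add: dist_norm adjoint_add algebra_simps)
  qed
  ultimately show "\<exists>W\<subseteq>U. openin ?T W \<and> W \<noteq> {} \<and> (\<forall>p\<in>W. \<forall>q\<in>W.
      dist (adjoint_op (A + rank_one scale f z) p) (adjoint_op (A + rank_one scale f z) q) < \<epsilon>)"
    using V(1) by (intro exI[of _ W]) (auto simp: W_def)
qed

text \<open>On a bounded set the adjoints of operators close in norm are uniformly close, and open
  fragmentation is stable under uniform limits.\<close>

lemma closed_flat_operators:
  assumes "\<Gamma> \<subseteq> dual_ball scale"
  shows "closed {A. flat_operator scale \<Gamma> A}"
proof -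
  have "flat_operator scale \<Gamma> S" if S: "S \<in> closure {A. flat_operator scale \<Gamma> A}" for S
    unfolding flat_operator_def openly_fragmented_iff
  proof (intro allI impI)
    fix U and \<epsilon> :: real
    let ?T = "subtopology (weak_star scale) \<Gamma>"
    assume U: "openin ?T U \<and> U \<noteq> {} \<and> 0 < \<epsilon>"
    then have "\<epsilon> / 3 > 0" by simp
    then obtain A where A: "flat_operator scale \<Gamma> A" "dist A S < \<epsilon> / 3"
      using S unfolding closure_approachable by blast
    then obtain V where V: "V \<subseteq> U" "openin ?T V" "V \<noteq> {}"
        "\<forall>p\<in>V. \<forall>q\<in>V. dist (adjoint_op A p) (adjoint_op A q) < \<epsilon> / 3"
      using U A(1)[unfolded flat_operator_def openly_fragmented_iff, rule_format, of U "\<epsilon> / 3"] by auto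
    have near: "dist (adjoint_op A p) (adjoint_op S p) < \<epsilon> / 3" if "p \<in> V" for p
    proof -
      have "p \<in> dual_ball scale"
        using that openin_subset[OF V(2)] assms by auto
      then have "norm p \<le> 1" by (simp add: dual_ball_def)
      have "adjoint_op A p - adjoint_op S p = adjoint_op (A - S) p"
        using adjoint_add[of "A - S" S p] by (simp add: algebra_simps)
      also have "norm \<dots> \<le> norm (A - S)"
        using norm_adjoint_le[of "A - S" p] \<open>norm p \<le> 1\<close>
        by (meson mult_left_le norm_ge_zero order_trans)
      finally show ?thesis
        using A(2) by (simp add: dist_norm)
    qed
    have "dist (adjoint_op S p) (adjoint_op S q) < \<epsilon>" if pq: "p \<in> V" "q \<in> V" for p q
    proof -
      have "dist (adjoint_op S p) (adjoint_op S q)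
          \<le> dist (adjoint_op A p) (adjoint_op S p) + dist (adjoint_op A p) (adjoint_op A q)
            + dist (adjoint_op A q) (adjoint_op S q)"
        using dist_triangle[of "adjoint_op S p" "adjoint_op S q" "adjoint_op A p"]
          dist_triangle[of "adjoint_op A p" "adjoint_op S q" "adjoint_op A q"]
        by (simp add: dist_commute)
      then show ?thesis
        using near[OF pq(1)] near[OF pq(2)] V(4) pq by fastforce
    qed
    then show "\<exists>V\<subseteq>U. openin ?T V \<and> V \<noteq> {} \<and> (\<forall>p\<in>V. \<forall>q\<in>V. dist (adjoint_op S p) (adjoint_op S q) < \<epsilon>)"
      using V by blast
  qed
  then show ?thesis
    by (metis closure_subset closure_eq mem_Collect_eq subset_antisym subsetI)
qed

end

section \<open>Adjoints that attain their norm at an extreme point\<close>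

context K_banach
begin

text \<open>
  The deficit \<open>M n - re (y (z n))\<close> is nonnegative on the dual ball. If \<open>u a + v b\<close> belongs to all
  slices, then its deficit is at most \<open>c n / (2 (n + 1))\<close>, so the deficit of \<open>a\<close> is at most
  \<open>c n / (2 (n + 1) u)\<close>. For large \<open>n\<close> this is below \<open>c n\<close>, and the slices decrease; hence \<open>a\<close>
  belongs to all of them. It is the factor \<open>n + 1\<close> that makes this work for arbitrarily small
  weights \<open>u\<close>, and so the intersection is a face.
\<close>

lemma extreme_point_in_nested_slices:
  fixes z :: "nat \<Rightarrow> 'x" and M c :: "nat \<Rightarrow> real"
  defines "H \<equiv> \<lambda>n. {y \<in> dual_ball scale. M n - c n \<le> re (blinfun_apply y (z n))}"
  assumes zM: "\<And>n. norm (z n) \<le> M n" and c: "\<And>n. c n \<ge> 0"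
    and nested: "\<And>n y. y \<in> H (Suc n) \<Longrightarrow> M n - c n / (2 * (real n + 1)) \<le> re (blinfun_apply y (z n))"
    and nonempty: "\<And>n. H n \<noteq> {}"
  shows "\<exists>e. e extreme_point_of dual_ball scale \<and> (\<forall>n. e \<in> H n)"
proof -
  have dec: "H (Suc n) \<subseteq> H n" for n
  proof
    fix y assume y: "y \<in> H (Suc n)"
    have "c n * 1 \<le> c n * (2 * (real n + 1))"
      using c by (intro mult_left_mono) auto
    then have "c n / (2 * (real n + 1)) \<le> c n"
      by (simp add: divide_le_eq)
    then show "y \<in> H n"
      using nested[OF y] y by (auto simp: H_def)
  qed
  then have mono: "H n \<subseteq> H m" if "m \<le> n" for m n
    using that by (rule lift_Suc_antimono_le)
  define F where "F = (\<Inter>n. H n)"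
  have closed_H: "closedin (weak_star scale) (H n)" for n
    unfolding H_def by (rule closedin_dual_ball_slice)
  have "F \<noteq> {}"
    unfolding F_def
  proof (rule Inter_chain_closed_nonempty)
    show "closedin (weak_star scale) N \<and> N \<subseteq> dual_ball scale \<and> N \<noteq> {}" if "N \<in> range H" for N
      using that nonempty closed_H by (auto simp: H_def)
    show "N \<subseteq> N' \<or> N' \<subseteq> N" if "N \<in> range H" "N' \<in> range H" for N N'
      using that mono by (metis imageE linear)
  qed simp
  have lin: "re (blinfun_apply (u *\<^sub>R a + v *\<^sub>R b) x)
        = u * re (blinfun_apply a x) + v * re (blinfun_apply b x)" for u v x and a b :: "'x \<Rightarrow>\<^sub>L 'k"
    by (simp add: blinfun.add_left blinfun.scaleR_left to_complex_add re_scaleR)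
  have step: "a \<in> F"
    if a: "a \<in> dual_ball scale" and b: "b \<in> dual_ball scale" and k: "u *\<^sub>R a + v *\<^sub>R b \<in> F"
      and uv: "0 < u" "0 < v" "u + v = 1" for a b u v
  proof -
    have large: "a \<in> H n" if n: "1 \<le> 2 * (real n + 1) * u" for n
    proof -
      have "u *\<^sub>R a + v *\<^sub>R b \<in> H (Suc n)"
        using k by (auto simp: F_def)
      then have "M n - c n / (2 * (real n + 1)) \<le> u * re (blinfun_apply a (z n)) + v * re (blinfun_apply b (z n))"
        using nested by (metis lin)
      moreover have "re (blinfun_apply b (z n)) \<le> M n"
        using re_le_norm norm_dual_ball_apply_le[OF b] zM by (meson order_trans)
      then have "v * re (blinfun_apply b (z n)) \<le> v * M n"
        using uv by simp
      ultimately have "(u + v) * M n - c n / (2 * (real n + 1)) \<le> u * re (blinfun_apply a (z n)) + v * M n"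
        unfolding uv(3) by linarith
      then have "u * (M n - re (blinfun_apply a (z n))) \<le> c n / (2 * (real n + 1))"
        by (simp add: algebra_simps)
      also have "\<dots> \<le> u * c n"
        using mult_right_mono[OF n c[of n]] by (simp add: divide_le_eq algebra_simps)
      finally have "M n - re (blinfun_apply a (z n)) \<le> c n"
        using uv by simp
      then show ?thesis
        using a by (simp add: H_def)
    qed
    obtain N :: nat where N: "1 / u \<le> real N"
      using real_arch_simple by blast
    have "1 \<le> 2 * (real n + 1) * u" if "N \<le> n" for n
    proof -
      have "1 \<le> real N * u" using N uv by (simp add: divide_le_eq)
      also have "\<dots> \<le> (2 * (real n + 1)) * u"
        using that uv by (intro mult_right_mono) auto
      finally show ?thesis .
    qed
    then have "a \<in> H (max n N)" for n
      by (intro large) simp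
    then have "a \<in> H n" for n
      using mono[of n "max n N"] by auto
    then show ?thesis by (simp add: F_def)
  qed
  have "F face_of dual_ball scale"
    unfolding face_of_def
  proof (intro conjI ballI impI)
    show sub: "F \<subseteq> dual_ball scale"
      by (auto simp: F_def H_def)
    show "convex F"
      unfolding F_def
    proof (rule convex_INT)
      fix n
      have "convex (dual_ball scale)"
      proof -
        have "dual_ball scale = dual scale \<inter> cball 0 1"
          by (auto simp: dual_ball_def)
        moreover have "convex (dual scale)"
          by (auto simp: convex_def dual_def blinfun.add_left blinfun.scaleR_left algebra_simps)
        ultimately show ?thesis
          by (simp add: convex_Int)
      qed
      moreover have "convex {y::'x \<Rightarrow>\<^sub>L 'k. M n - c n \<le> re (blinfun_apply y (z n))}"
        unfolding convex_def
      proof (intro ballI allI impI)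
        fix a b :: "'x \<Rightarrow>\<^sub>L 'k" and u v :: real
        assume "a \<in> {y. M n - c n \<le> re (blinfun_apply y (z n))}"
          "b \<in> {y. M n - c n \<le> re (blinfun_apply y (z n))}" and uv: "0 \<le> u" "0 \<le> v" "u + v = 1"
        then have "u * (M n - c n) + v * (M n - c n) \<le> u * re (blinfun_apply a (z n)) + v * re (blinfun_apply b (z n))"
          by (intro add_mono mult_left_mono) auto
        then show "u *\<^sub>R a + v *\<^sub>R b \<in> {y. M n - c n \<le> re (blinfun_apply y (z n))}"
          using uv by (simp add: lin flip: distrib_right)
      qed
      ultimately have "convex (dual_ball scale \<inter> {y. M n - c n \<le> re (blinfun_apply y (z n))})"
        by (rule convex_Int)
      moreover have "dual_ball scale \<inter> {y. M n - c n \<le> re (blinfun_apply y (z n))} = H n"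
        by (auto simp: H_def)
      ultimately show "convex (H n)" by simp
    qed
    fix a b k assume ab: "a \<in> dual_ball scale" "b \<in> dual_ball scale" "k \<in> F" "k \<in> open_segment a b"
    then obtain u where u: "0 < u" "u < 1" "k = (1 - u) *\<^sub>R a + u *\<^sub>R b"
      by (auto simp: in_segment)
    show "a \<in> F"
      using step[of a b "1 - u" u] ab u by auto
    show "b \<in> F"
      using step[of b a u "1 - u"] ab u by (auto simp: add.commute)
  qed
  moreover have "closedin (weak_star scale) F"
    unfolding F_def using closed_H by (intro closedin_INT) auto
  ultimately obtain e where "e \<in> F" "e extreme_point_of dual_ball scale"
    using extreme_point_in_closed_face \<open>F \<noteq> {}\<close> by blast
  then show ?thesis by (auto simp: F_def)
qed

end

context K_banach_pair
begin

text \<open>One step of the iteration: \<open>A\<close> is enlarged in the direction \<open>A x\<close> in which it is almost norming.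
  The division by \<open>norm A\<close> makes the perturbation at most \<open>t\<close> times the norm of \<open>A\<close>.\<close>

definition bump :: "('x \<Rightarrow>\<^sub>L 'y) \<Rightarrow> 'x \<Rightarrow> ('y \<Rightarrow>\<^sub>L 'k) \<Rightarrow> real \<Rightarrow> ('x \<Rightarrow>\<^sub>L 'y)"
  where "bump A x e t = A + rank_one sY ((t / norm A) *\<^sub>R adjoint_op A e) (blinfun_apply A x)"

lemma bump_apply:
  "blinfun_apply (bump A x e t) x' = blinfun_apply A x'
     + (t / norm A) *\<^sub>R sY (blinfun_apply e (blinfun_apply A x')) (blinfun_apply A x)"
  by (simp add: bump_def blinfun.add_left Y.rank_one_apply blinfun.scaleR_left apply_adjoint Y.scale_scaleR_left)

lemma norm_bump_diff_le:
  assumes "norm x \<le> 1" "e \<in> dual_ball sY" "0 \<le> t"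
  shows "norm (bump A x e t - A) \<le> t * norm A"
proof -
  have "norm e \<le> 1" using assms by (simp add: dual_ball_def)
  have "norm (bump A x e t - A) \<le> norm ((t / norm A) *\<^sub>R adjoint_op A e) * norm (blinfun_apply A x)"
    unfolding bump_def add_diff_cancel_left' by (rule Y.norm_rank_one_le)
  also have "\<dots> \<le> (t / norm A * norm A) * norm A"
  proof (intro mult_mono)
    have "norm (adjoint_op A e) \<le> norm A"
      using norm_adjoint_le[of A e] \<open>norm e \<le> 1\<close> by (meson mult_left_le norm_ge_zero order_trans)
    then have "t / norm A * norm (adjoint_op A e) \<le> t / norm A * norm A"
      using assms by (intro mult_left_mono) auto
    then show "norm ((t / norm A) *\<^sub>R adjoint_op A e) \<le> t / norm A * norm A"
      using assms by simp
    show "norm (blinfun_apply A x) \<le> norm A"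
      by (rule norm_apply_le_ball) fact
  qed (use assms in auto)
  also have "\<dots> \<le> t * norm A"
    using assms by (cases "A = 0") auto
  finally show ?thesis .
qed

lemma norm_bump_ge:
  assumes "norm x \<le> 1" "blinfun_apply e (blinfun_apply A x) = of_real (norm (blinfun_apply A x))" "0 \<le> t"
  shows "norm (blinfun_apply A x) + t / norm A * (norm (blinfun_apply A x))\<^sup>2 \<le> norm (bump A x e t)"
proof -
  define p where "p = norm (blinfun_apply A x)"
  have "blinfun_apply (bump A x e t) x = (1 + t / norm A * p) *\<^sub>R blinfun_apply A x"
    by (simp add: bump_apply assms(2) Y.scale_of_real p_def scaleR_add_left)
  then have "norm (blinfun_apply (bump A x e t) x) = (1 + t / norm A * p) * p"
    using assms(3) by (simp add: p_def)
  then have "(1 + t / norm A * p) * p \<le> norm (bump A x e t)"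
    using norm_apply_le_ball[OF assms(1)] by metis
  then show ?thesis by (simp add: p_def power2_eq_square algebra_simps)
qed

text \<open>
  The value of the new operator at \<open>x'\<close> is \<open>A x'\<close> plus a multiple of \<open>A x\<close>. A functional \<open>y\<close> that almost
  norms it can lose only little on either summand; as the first contributes at most \<open>norm A\<close>, the
  second must be nearly maximal, which forces \<open>re (y (A x))\<close> to be near \<open>norm A\<close>. The alignment
  makes the multiple of \<open>A x\<close> nonnegative; without it only the modulus of \<open>y (A x)\<close> would be
  controlled, and sets defined by the modulus are not convex. The errors
  get divided by the step size, which is why \<open>t\<close> is a factor of the permitted error.
\<close>

lemma bump_slice:
  assumes x: "norm x \<le> 1" and e: "e \<in> dual_ball sY"
    and ex: "blinfun_apply e (blinfun_apply A x) = of_real (norm (blinfun_apply A x))"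
    and t: "0 < t" "t \<le> 1" and c: "0 < c" "c \<le> norm A" and \<kappa>: "1 \<le> \<kappa>"
    and near: "norm A - c * t / (8 * \<kappa>) \<le> norm (blinfun_apply A x)"
    and x': "norm x' \<le> 1"
    and aligned: "blinfun_apply e (blinfun_apply A x') = of_real (norm (blinfun_apply e (blinfun_apply A x')))"
    and y: "y \<in> dual_ball sY"
    and slice: "norm (bump A x e t) - c * t / (8 * \<kappa>) \<le> re (blinfun_apply y (blinfun_apply (bump A x e t) x'))"
  shows "norm A - c / (2 * \<kappa>) \<le> re (blinfun_apply y (blinfun_apply A x))"
proof -
  define M p a s \<delta> where "M = norm A" and "p = norm (blinfun_apply A x)"
    and "a = norm (blinfun_apply e (blinfun_apply A x'))"
    and "s = re (blinfun_apply y (blinfun_apply A x))" and "\<delta> = c * t / (8 * \<kappa>)"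
  have M: "M > 0" and cM: "c \<le> M" using c by (auto simp: M_def)
  have a: "0 \<le> a" "a \<le> M"
    using norm_dual_ball_apply_le[OF e, of "blinfun_apply A x'"] norm_apply_le_ball[OF x', of A]
    by (auto simp: a_def M_def)
  have p: "M - \<delta> \<le> p" using near by (simp add: M_def p_def \<delta>_def)
  have \<delta>: "0 < \<delta>" using c t \<kappa> by (simp add: \<delta>_def)
  have "c * t \<le> c * 1" using c t by (intro mult_left_mono) auto
  then have \<delta>c: "\<delta> \<le> c / (8 * \<kappa>)"
    using \<kappa> by (simp add: \<delta>_def divide_right_mono)
  have ck: "c / (8 * \<kappa>) \<le> c / 8" using c \<kappa> by (intro divide_left_mono) auto
  have "blinfun_apply y (blinfun_apply (bump A x e t) x')
      = blinfun_apply y (blinfun_apply A x') + (t / M * a) *\<^sub>R blinfun_apply y (blinfun_apply A x)"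
    by (subst bump_apply, subst aligned)
      (simp add: Y.scale_of_real a_def M_def blinfun.add_right blinfun.scaleR_right)
  then have "re (blinfun_apply y (blinfun_apply (bump A x e t) x'))
      = re (blinfun_apply y (blinfun_apply A x')) + t / M * a * s"
    by (simp add: to_complex_add to_complex_scaleR s_def)
  moreover have "re (blinfun_apply y (blinfun_apply A x')) \<le> M"
    using re_le_norm norm_dual_ball_apply_le[OF y] norm_apply_le_ball[OF x', of A]
    unfolding M_def by (meson order_trans)
  moreover have "p + t / M * p\<^sup>2 \<le> norm (bump A x e t)"
    unfolding p_def M_def using x ex t by (intro norm_bump_ge) auto
  ultimately have "p + t / M * p\<^sup>2 - \<delta> \<le> M + t / M * a * s"
    using slice by (simp add: \<delta>_def)
  then have "t / M * p\<^sup>2 - 2 * \<delta> \<le> t / M * (a * s)"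
    using p by (simp add: mult.assoc)
  then have "(t / M * p\<^sup>2 - 2 * \<delta>) * (M / t) \<le> t / M * (a * s) * (M / t)"
    using M t by (intro mult_right_mono) auto
  moreover have "(t / M * p\<^sup>2 - 2 * \<delta>) * (M / t) = p\<^sup>2 - c * M / (4 * \<kappa>)"
    using M t \<kappa> by (simp add: \<delta>_def field_simps)
  ultimately have as: "p\<^sup>2 - c * M / (4 * \<kappa>) \<le> a * s"
    using M t by simp
  have "0 \<le> M - \<delta>" using \<delta>c ck cM M by linarith
  then have "(M - \<delta>)\<^sup>2 \<le> p\<^sup>2" using p by (intro power_mono)
  moreover have "M * M - 2 * (M * \<delta>) \<le> (M - \<delta>)\<^sup>2"
    using power2_diff[of M \<delta>] zero_le_power2[of \<delta>] by (simp only: power2_eq_square)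
  moreover have "M * \<delta> \<le> M * (c / (8 * \<kappa>))" using \<delta>c M by (intro mult_left_mono) auto
  ultimately have "M * M - 2 * (M * (c / (8 * \<kappa>))) - c * M / (4 * \<kappa>) \<le> a * s"
    using as by linarith
  moreover have "M * (M - c / (2 * \<kappa>)) = M * M - 2 * (M * (c / (8 * \<kappa>))) - c * M / (4 * \<kappa>)"
    using \<kappa> by (simp add: field_simps)
  ultimately have as2: "M * (M - c / (2 * \<kappa>)) \<le> a * s" by simp
  have "c / (2 * \<kappa>) \<le> c / 2" using c \<kappa> by (intro divide_left_mono) auto
  then have "0 < M - c / (2 * \<kappa>)" using cM c by linarith
  then have "0 < a * s" using as2 M by (meson less_le_trans mult_pos_pos)
  then have "0 < s" using a by (simp add: zero_less_mult_iff)
  then have "a * s \<le> M * s" using a by simp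
  then have "M * (M - c / (2 * \<kappa>)) \<le> M * s" using as2 by linarith
  then show ?thesis using M by (simp add: M_def s_def)
qed


lemma almost_norming_aligned_vector:
  assumes A: "A \<in> K_operators sX sY" and B: "B \<in> K_operators sX sY" and e: "e \<in> dual_ball sY" and "\<delta> > 0"
  shows "\<exists>x. norm x \<le> 1 \<and> norm A - \<delta> < norm (blinfun_apply A x) \<and>
    blinfun_apply e (blinfun_apply B x) = of_real (norm (blinfun_apply e (blinfun_apply B x)))"
proof -
  obtain x where x: "norm x \<le> 1" "norm A - \<delta> < norm (blinfun_apply A x)"
    using almost_norming_vector[OF \<open>\<delta> > 0\<close>] by blast
  obtain \<theta> where \<theta>: "norm \<theta> = 1"
      "\<theta> * blinfun_apply e (blinfun_apply B x) = of_real (norm (blinfun_apply e (blinfun_apply B x)))"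
    using exists_phase by blast
  have "blinfun_apply A (sX \<theta> x) = sY \<theta> (blinfun_apply A x)" "blinfun_apply B (sX \<theta> x) = sY \<theta> (blinfun_apply B x)"
    using A B by (auto simp: K_operators_def)
  moreover have "blinfun_apply e (sY \<theta> w) = \<theta> * blinfun_apply e w" for w
    using e by (simp add: dual_ball_def dual_def)
  ultimately show ?thesis
    using x \<theta> by (intro exI[of _ "sX \<theta> x"]) (simp add: X.norm_scale Y.norm_scale norm_mult)
qed

text \<open>
  The iteration records an operator \<open>A\<close>, an almost norming vector \<open>x\<close>, a functional \<open>e\<close> norming \<open>A x\<close>,
  a step size \<open>t\<close> and a tolerance \<open>c\<close>. The functional \<open>e\<close> serves to align the next vector. The
  extreme point in all slices almost norms each \<open>A x\<close> up to the tolerance \<open>c\<close>, which tends to zero.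
\<close>

lemma adjoint_attains_norm_at_extreme_point:
  assumes norming: "one_norming sY \<Gamma>" and G: "\<G> \<subseteq> K_operators sX sY" "closed \<G>"
    and rank_one: "\<And>A f z. A \<in> \<G> \<Longrightarrow> f \<in> dual sX \<Longrightarrow> A + rank_one sY f z \<in> \<G>"
    and T: "T \<in> \<G>" "T \<noteq> 0" and \<epsilon>: "\<epsilon> > 0"
  shows "\<exists>S\<in>\<G>. norm (S - T) \<le> \<epsilon> \<and>
    (\<exists>e. e extreme_point_of dual_ball sY \<and> norm (adjoint_op S e) = norm S)"
proof -
  define P where "P n s \<longleftrightarrow> (case s of (A, x, e, t, c) \<Rightarrow>
      A \<in> \<G> \<and> norm x \<le> 1 \<and> e \<in> dual_ball sY \<and>
      blinfun_apply e (blinfun_apply A x) = of_real (norm (blinfun_apply A x)) \<and>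
      0 < t \<and> t \<le> 1 \<and> t * norm A \<le> \<epsilon> * (1/2) ^ Suc n \<and> 0 < c \<and> c \<le> norm A \<and>
      norm A - c * t / (8 * (real n + 1)) < norm (blinfun_apply A x) \<and>
      (n = 0 \<longrightarrow> A = T))"
    for n and s :: "('x \<Rightarrow>\<^sub>L 'y) \<times> 'x \<times> ('y \<Rightarrow>\<^sub>L 'k) \<times> real \<times> real"
  define Q where "Q n s s' \<longleftrightarrow> (case s of (A, x, e, t, c) \<Rightarrow> case s' of (A', x', e', t', c') \<Rightarrow>
      norm (A' - A) \<le> \<epsilon> * (1/2) ^ Suc n \<and> c' \<le> c / 2 \<and>
      (\<forall>y\<in>dual_ball sY. norm A' - c' \<le> re (blinfun_apply y (blinfun_apply A' x'))
        \<longrightarrow> norm A - c / (2 * (real n + 1)) \<le> re (blinfun_apply y (blinfun_apply A x))))"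
    for n and s s' :: "('x \<Rightarrow>\<^sub>L 'y) \<times> 'x \<times> ('y \<Rightarrow>\<^sub>L 'k) \<times> real \<times> real"
  have next_t: "\<exists>t. 0 < t \<and> t \<le> 1 \<and> t * norm A \<le> \<epsilon> * (1/2) ^ Suc n" for n and A :: "'x \<Rightarrow>\<^sub>L 'y"
  proof -
    define q where "q = \<epsilon> * (1/2) ^ Suc n"
    have "q > 0" using \<epsilon> by (simp add: q_def)
    have "min 1 (q / (norm A + 1)) * norm A \<le> q / (norm A + 1) * (norm A + 1)"
      using \<open>q > 0\<close> by (intro mult_mono) auto
    also have "\<dots> = q"
      using norm_ge_zero[of A] by (simp add: add_nonneg_eq_0_iff)
    finally show ?thesis
      using \<open>q > 0\<close> unfolding q_def[symmetric]
      by (intro exI[of _ "min 1 (q / (norm A + 1))"]) (simp add: add_nonneg_pos)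
  qed
  have "\<exists>s. P 0 s"
  proof -
    obtain t where t: "0 < t" "t \<le> 1" "t * norm T \<le> \<epsilon> * (1/2) ^ Suc 0"
      using next_t by blast
    have "norm T * t / (8 * (real 0 + 1)) > 0" using t T by simp
    then obtain x where x: "norm x \<le> 1" "norm T - norm T * t / (8 * (real 0 + 1)) < norm (blinfun_apply T x)"
      using almost_norming_vector by blast
    obtain e where e: "e \<in> dual_ball sY" "blinfun_apply e (blinfun_apply T x) = of_real (norm (blinfun_apply T x))"
      using Y.norming_functional[OF norming] by blast
    have "P 0 (T, x, e, t, norm T)"
      unfolding P_def using t T x e by simp
    then show ?thesis by blast
  qed
  moreover have "\<exists>s'. P (Suc n) s' \<and> Q n s s'" if "P n s" for n s
  proof -
    obtain A x e t c where s: "s = (A, x, e, t, c)" by (cases s) auto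
    have A: "A \<in> \<G>" and x: "norm x \<le> 1" and e: "e \<in> dual_ball sY"
      and ex: "blinfun_apply e (blinfun_apply A x) = of_real (norm (blinfun_apply A x))"
      and t: "0 < t" "t \<le> 1" and tA: "t * norm A \<le> \<epsilon> * (1/2) ^ Suc n" and c: "0 < c" "c \<le> norm A"
      and near: "norm A - c * t / (8 * (real n + 1)) \<le> norm (blinfun_apply A x)"
      using that unfolding P_def s by auto
    define \<delta> where "\<delta> = c * t / (8 * (real n + 1))"
    define A' where "A' = bump A x e t"
    have "adjoint_op A e \<in> dual sX"
      using A G e by (intro adjoint_dual) (auto simp: dual_ball_def)
    then have A': "A' \<in> \<G>"
      unfolding A'_def bump_def by (intro rank_one A dual_scaleR)
    have "\<delta> > 0" using c t by (simp add: \<delta>_def)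
    have "c * t \<le> c * 1" using c t by (intro mult_left_mono) auto
    then have "\<delta> \<le> c / (8 * (real n + 1))"
      by (simp add: \<delta>_def divide_right_mono)
    also have "\<dots> \<le> c / 2" using c by (intro divide_left_mono) auto
    finally have \<delta>c: "\<delta> \<le> c / 2" .
    then have "0 < norm (blinfun_apply A x)" using near c unfolding \<delta>_def by linarith
    then have "0 < norm (blinfun_apply A x) + t / norm A * (norm (blinfun_apply A x))\<^sup>2"
      using t by (intro add_pos_nonneg) auto
    then have "0 < norm A'"
      using norm_bump_ge[OF x ex less_imp_le[OF t(1)]] unfolding A'_def by linarith
    \<comment> \<open>The next tolerance is of the order of the present error \<open>\<delta>\<close>, so that the next slice is contained
      in a much smaller one than the present slice; \<open>norm A'\<close> only keeps it admissible.\<close>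
    define c' where "c' = min \<delta> (norm A')"
    have c': "0 < c'" "c' \<le> norm A'" "c' \<le> \<delta>"
      using \<open>0 < norm A'\<close> \<open>\<delta> > 0\<close> by (auto simp: c'_def)
    obtain t' where t': "0 < t'" "t' \<le> 1" "t' * norm A' \<le> \<epsilon> * (1/2) ^ Suc (Suc n)"
      using next_t by blast
    have "c' * t' / (8 * (real (Suc n) + 1)) > 0" using c' t' by simp
    then obtain x' where x': "norm x' \<le> 1"
        "norm A' - c' * t' / (8 * (real (Suc n) + 1)) < norm (blinfun_apply A' x')"
        "blinfun_apply e (blinfun_apply A x') = of_real (norm (blinfun_apply e (blinfun_apply A x')))"
      using almost_norming_aligned_vector[of A' A e] A A' G e by blast
    obtain e' where e': "e' \<in> dual_ball sY" "blinfun_apply e' (blinfun_apply A' x') = of_real (norm (blinfun_apply A' x'))"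
      using Y.norming_functional[OF norming] by blast
    have "P (Suc n) (A', x', e', t', c')"
      unfolding P_def using A' x' e' t' c' by auto
    moreover have "Q n s (A', x', e', t', c')"
      unfolding Q_def s prod.case
    proof (intro conjI ballI impI)
      show "norm (A' - A) \<le> \<epsilon> * (1/2) ^ Suc n"
        using norm_bump_diff_le[OF x e, of t A] t tA unfolding A'_def by linarith
      show "c' \<le> c / 2" using c' \<delta>c by linarith
      fix y assume y: "y \<in> dual_ball sY" "norm A' - c' \<le> re (blinfun_apply y (blinfun_apply A' x'))"
      have "norm A' - \<delta> \<le> re (blinfun_apply y (blinfun_apply A' x'))"
        using y(2) c' by linarith
      then show "norm A - c / (2 * (real n + 1)) \<le> re (blinfun_apply y (blinfun_apply A x))"
        unfolding A'_def \<delta>_def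
        by (intro bump_slice[OF x e ex t c _ near x'(1) x'(3) y(1)]) auto
    qed
    ultimately show ?thesis by blast
  qed
  ultimately obtain s where s: "\<And>n. P n (s n)" "\<And>n. Q n (s n) (s (Suc n))"
    using dependent_nat_choice[of P Q] by metis
  define A x e c where "A n = fst (s n)" and "x n = fst (snd (s n))"
    and "e n = fst (snd (snd (s n)))" and "c n = snd (snd (snd (snd (s n))))" for n
  define t where "t n = fst (snd (snd (snd (s n))))" for n
  have seq: "s n = (A n, x n, e n, t n, c n)" for n
    by (simp add: A_def x_def e_def c_def t_def)
  have AG: "A n \<in> \<G>" and x: "norm (x n) \<le> 1" and e: "e n \<in> dual_ball sY"
    and ex: "blinfun_apply (e n) (blinfun_apply (A n) (x n)) = of_real (norm (blinfun_apply (A n) (x n)))"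
    and t: "0 < t n" "t n \<le> 1" and c: "0 < c n"
    and near: "norm (A n) - c n * t n / (8 * (real n + 1)) < norm (blinfun_apply (A n) (x n))" for n
    using s(1)[of n] unfolding P_def seq by auto
  have A0: "A 0 = T" using s(1)[of 0] unfolding P_def seq by auto
  have step: "norm (A (Suc n) - A n) \<le> \<epsilon> * (1/2) ^ Suc n" and c_half: "c (Suc n) \<le> c n / 2"
    and nested: "\<And>y. y \<in> dual_ball sY \<Longrightarrow>
        norm (A (Suc n)) - c (Suc n) \<le> re (blinfun_apply y (blinfun_apply (A (Suc n)) (x (Suc n))))
        \<Longrightarrow> norm (A n) - c n / (2 * (real n + 1)) \<le> re (blinfun_apply y (blinfun_apply (A n) (x n)))" for n
    using s(2)[of n] unfolding Q_def seq by auto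
  have geom: "(\<lambda>n. \<epsilon> * (1/2) ^ Suc n) sums (\<epsilon> * 1)"
    by (intro sums_mult power_half_series)
  then have sm: "summable (\<lambda>n. norm (A (Suc n) - A n))"
  proof (rule summable_comparison_test'[OF sums_summable, of _ _ 0])
    show "norm (norm (A (Suc n) - A n)) \<le> \<epsilon> * (1/2) ^ Suc n" for n
      unfolding real_norm_def abs_norm_cancel by (rule step)
  qed
  define S where "S = A 0 + (\<Sum>n. A (Suc n) - A n)"
  have "(\<lambda>n. A 0 + (\<Sum>k<n. A (Suc k) - A k)) \<longlonglongrightarrow> S"
    unfolding S_def by (intro tendsto_add tendsto_const summable_LIMSEQ summable_norm_cancel[OF sm])
  then have lim: "A \<longlonglongrightarrow> S"
    by (simp add: sum_lessThan_telescope)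
  then have SG: "S \<in> \<G>"
    using AG \<open>closed \<G>\<close> closed_sequentially by blast
  have "norm (S - T) \<le> (\<Sum>n. norm (A (Suc n) - A n))"
    using summable_norm[OF sm] by (simp add: S_def A0)
  also have "\<dots> \<le> (\<Sum>n. \<epsilon> * (1/2) ^ Suc n)"
    by (rule suminf_le[OF step sm sums_summable[OF geom]])
  also have "\<dots> = \<epsilon>" using sums_unique[OF geom] by simp
  finally have ST: "norm (S - T) \<le> \<epsilon>" .
  have c_pow: "c n \<le> c 0 * (1/2) ^ n" for n
  proof (induction n)
    case (Suc n)
    then show ?case using c_half[of n] by simp
  qed simp
  have "(\<lambda>n. c 0 * (1/2) ^ n) \<longlonglongrightarrow> c 0 * 0"
    by (intro tendsto_mult tendsto_const LIMSEQ_power_zero) simp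
  then have c_lim: "c \<longlonglongrightarrow> 0"
    using c c_pow by (intro tendsto_sandwich[of "\<lambda>_. 0" c sequentially "\<lambda>n. c 0 * (1/2) ^ n"])
      (auto intro!: always_eventually less_imp_le)
  have "\<exists>e'. e' extreme_point_of dual_ball sY \<and> (\<forall>n. e' \<in>
      {y \<in> dual_ball sY. norm (A n) - c n \<le> re (blinfun_apply y (blinfun_apply (A n) (x n)))})"
  proof (rule Y.extreme_point_in_nested_slices)
    show "norm (blinfun_apply (A n) (x n)) \<le> norm (A n)" for n
      using x by (rule norm_apply_le_ball)
    show "0 \<le> c n" for n using c[of n] by simp
    show "norm (A n) - c n / (2 * (real n + 1)) \<le> re (blinfun_apply y (blinfun_apply (A n) (x n)))"
      if "y \<in> {y \<in> dual_ball sY. norm (A (Suc n)) - c (Suc n)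
          \<le> re (blinfun_apply y (blinfun_apply (A (Suc n)) (x (Suc n))))}" for n y
      using that nested by blast
    have "norm (A n) - c n \<le> re (blinfun_apply (e n) (blinfun_apply (A n) (x n)))" for n
    proof -
      have "c n * t n \<le> c n * (8 * (real n + 1))"
        using c[of n] t[of n] by (intro mult_left_mono) auto
      then have "c n * t n / (8 * (real n + 1)) \<le> c n"
        by (simp add: divide_le_eq)
      then show ?thesis
        using near[of n] by (simp add: ex re_of_real)
    qed
    then show "{y \<in> dual_ball sY. norm (A n) - c n \<le> re (blinfun_apply y (blinfun_apply (A n) (x n)))} \<noteq> {}" for n
      using e by blast
  qed
  then obtain e' where e': "e' extreme_point_of dual_ball sY" "e' \<in> dual_ball sY"
      "\<And>n. norm (A n) - c n \<le> re (blinfun_apply e' (blinfun_apply (A n) (x n)))"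
    by blast
  have e'1: "norm e' \<le> 1" using e'(2) by (simp add: dual_ball_def)
  have "norm (A n) - c n - norm (A n - S) \<le> norm (adjoint_op S e')" for n
  proof -
    have "blinfun_apply e' (blinfun_apply (A n) (x n))
        = blinfun_apply e' (blinfun_apply (A n - S) (x n)) + blinfun_apply (adjoint_op S e') (x n)"
      by (simp add: apply_adjoint blinfun.diff_left blinfun.diff_right)
    then have "re (blinfun_apply e' (blinfun_apply (A n) (x n)))
        \<le> norm (blinfun_apply e' (blinfun_apply (A n - S) (x n))) + norm (blinfun_apply (adjoint_op S e') (x n))"
      by (metis norm_triangle_ineq order_trans re_le_norm)
    moreover have "norm (blinfun_apply e' (blinfun_apply (A n - S) (x n))) \<le> norm (A n - S)"
      using norm_dual_ball_apply_le[OF e'(2)] norm_apply_le_ball[OF x] by (meson order_trans)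
    moreover have "norm (blinfun_apply (adjoint_op S e') (x n)) \<le> norm (adjoint_op S e')"
      by (rule norm_apply_le_ball[OF x])
    ultimately show ?thesis using e'(3)[of n] by linarith
  qed
  moreover have "(\<lambda>n. norm (A n) - c n - norm (A n - S)) \<longlonglongrightarrow> norm S - 0 - norm (S - S)"
    by (intro tendsto_intros lim c_lim)
  ultimately have "norm S \<le> norm (adjoint_op S e')"
    using LIMSEQ_le_const2 by fastforce
  moreover have "norm (adjoint_op S e') \<le> norm S"
    using norm_adjoint_le[of S e'] e'1 by (meson mult_left_le norm_ge_zero order_trans)
  ultimately show ?thesis
    using SG ST e'(1) by (metis antisym)
qed

end

section \<open>The modified operator\<close>

lemma norm_scale_functional_le: "norm (scale_functional a f) \<le> norm a * norm f"
  unfolding scale_functional_def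
  by (rule norm_blinfun_bound) (simp_all add: norm_mult mult.assoc mult_left_mono norm_blinfun)

lemma scale_functional_apply: "blinfun_apply (scale_functional a f) x = a * blinfun_apply f x"
  by (simp add: scale_functional_def)

lemma scale_functional_diff: "scale_functional a (f - g) = scale_functional a f - scale_functional a g"
  by (intro blinfun_eqI) (simp add: scale_functional_apply blinfun.diff_left right_diff_distrib)

lemma scale_functional_diff_left: "scale_functional (a - b) f = scale_functional a f - scale_functional b f"
  by (intro blinfun_eqI) (simp add: scale_functional_apply blinfun.diff_left left_diff_distrib)

lemma scale_functional_one: "scale_functional 1 f = f"
  by (intro blinfun_eqI) (simp add: scale_functional_apply)

lemma infdist_less_witness:
  assumes "infdist x A < e" "A \<noteq> {}"
  shows "\<exists>a\<in>A. dist x a < e"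
  using assms by (simp add: infdist_notempty cINF_less_iff bdd_below_def) 
    (metis cINF_less_iff bdd_below.I2 zero_le_dist)

text \<open>Both terms of the difference depend linearly on the functional, so the estimate passes from a set
  to its absolutely convex hull.\<close>

lemma adjoint_near_rank_one_on_hull:
  fixes S :: "'x::banach \<Rightarrow>\<^sub>L 'y::banach" and f :: "'x \<Rightarrow>\<^sub>L 'k::real_or_complex"
  assumes V: "\<And>v. v \<in> V \<Longrightarrow> norm (adjoint_op S v - scale_functional (blinfun_apply v e) f) \<le> c"
    and "0 \<le> c" and g: "g \<in> absolutely_convex hull ({0} \<union> V)"
  shows "norm (adjoint_op S g - scale_functional (blinfun_apply g e) f) \<le> c"
proof -
  define h where "h g = adjoint_op S g - scale_functional (blinfun_apply g e) f" for g
  have lin: "h (scale_functional a p + scale_functional b q) = scale_functional a (h p) + scale_functional b (h q)"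
    for a b p q
    by (intro blinfun_eqI)
      (simp add: h_def apply_adjoint scale_functional_apply blinfun.add_left blinfun.diff_left algebra_simps)
  have "absolutely_convex hull ({0} \<union> V) \<subseteq> {g. norm (h g) \<le> c}"
  proof (rule hull_minimal)
    have "h 0 = 0"
      by (intro blinfun_eqI) (simp add: h_def apply_adjoint scale_functional_apply blinfun.diff_left)
    then show "{0} \<union> V \<subseteq> {g. norm (h g) \<le> c}"
      using V \<open>0 \<le> c\<close> by (auto simp: h_def)
    show "absolutely_convex {g. norm (h g) \<le> c}"
      unfolding absolutely_convex_def
    proof (intro ballI allI impI)
      fix p q and a b :: 'k
      assume p: "p \<in> {g. norm (h g) \<le> c}" and q: "q \<in> {g. norm (h g) \<le> c}" and ab: "norm a + norm b \<le> 1"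
      have "norm (h (scale_functional a p + scale_functional b q)) \<le> norm a * norm (h p) + norm b * norm (h q)"
        unfolding lin by (intro norm_triangle_mono norm_scale_functional_le)
      also have "\<dots> \<le> norm a * c + norm b * c"
        using p q by (intro add_mono mult_left_mono) auto
      also have "\<dots> \<le> 1 * c"
        unfolding distrib_right[symmetric] using ab \<open>0 \<le> c\<close> by (intro mult_right_mono)
      finally show "scale_functional a p + scale_functional b q \<in> {g. norm (h g) \<le> c}" by simp
    qed
  qed
  then show ?thesis using g by (auto simp: h_def)
qed

context K_banach_pair
begin

lemma norm_le_by_norming:
  assumes \<Gamma>: "one_norming sY \<Gamma>" and "\<And>y. y \<in> \<Gamma> \<Longrightarrow> norm (adjoint_op A y) \<le> c"
  shows "norm (A :: 'x \<Rightarrow>\<^sub>L 'y) \<le> c"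
proof (rule norm_blinfun_bound)
  obtain y where "y \<in> \<Gamma>" using Y.one_norming_nonempty[OF \<Gamma>] by blast
  then show "0 \<le> c" using assms(2) norm_ge_zero order_trans by blast
  fix x
  show "norm (blinfun_apply A x) \<le> c * norm x"
  proof (rule ccontr)
    assume "\<not> ?thesis"
    then obtain y where y: "y \<in> \<Gamma>" "c * norm x < norm (blinfun_apply y (blinfun_apply A x))"
      using Y.one_norming_witness[OF \<Gamma>] by (meson not_le)
    have "norm (blinfun_apply (adjoint_op A y) x) \<le> c * norm x"
      using norm_blinfun[of "adjoint_op A y" x] mult_right_mono[OF assms(2)[OF y(1)], of "norm x"] by simp
    then show False using y(2) by (simp add: apply_adjoint)
  qed
qed

text \<open>
  The number \<open>\<delta>\<close> is fixed by balancing. For \<open>y\<close> outside \<open>V1\<close> the norm of \<open>adjoint_op R y\<close> is at most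
  \<open>(1 - \<eta>) m + \<eta> r m\<close>, which is \<open>m - \<eta> (1 - r) m\<close>, up to errors adding up to \<open>2 \<delta> + 3 m \<delta>\<close>; since
  \<open>norm f2\<close> is at least \<open>m - 2 \<delta>\<close>, the choice \<open>\<eta> (1 - r) m = (5 + 3 m) \<delta>\<close> leaves the margin \<open>\<delta>\<close>. So
  only functionals in \<open>V1\<close> can almost norm a vector \<open>R x\<close>, and for these the defining
  inequality of \<open>V1\<close> shows that the contribution of \<open>f2 x\<close> must be nearly \<open>norm f2\<close>.
\<close>

lemma modified_operator_estimates:
  fixes S :: "'x \<Rightarrow>\<^sub>L 'y" and F :: "'y \<Rightarrow>\<^sub>L 'y" and y1 :: "'y \<Rightarrow>\<^sub>L 'k" and f2 :: "'x \<Rightarrow>\<^sub>L 'k"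
  defines "m \<equiv> norm S" and "f1 \<equiv> adjoint_op S y1"
  assumes norming: "one_norming sY \<Gamma>" and m: "0 < m"
    and \<eta>: "0 < \<eta>" "\<eta> < 1" and r: "0 \<le> r" "r < 1" and \<delta>: "\<delta> * (5 + 3 * m) = \<eta> * (1 - r) * m"
    and V: "V \<subseteq> \<Gamma>" "y1 \<in> V" and e: "norm e = 1"
    and wit: "quasi_ACK_witness sY \<Gamma> \<rho> \<delta> V y1 e F" and \<rho>: "\<rho> y1 \<le> r"
    and diam: "\<And>v. v \<in> V \<Longrightarrow> norm (adjoint_op S v - f1) \<le> \<delta>"
    and f1: "m - \<delta> < norm f1" and f2: "norm (f2 - f1) < \<delta>"
    and R: "R = rank_one sY f2 (blinfun_apply F e) + (1 - \<eta>) *\<^sub>R (S - (F o\<^sub>L S))"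
  shows "norm (R - S) \<le> 3 * \<eta> * m" and "f2 \<noteq> 0" and "norm R = norm f2"
    and "\<And>x. norm (blinfun_apply f2 x) \<le> norm (blinfun_apply R x)"
    and "\<exists>t0>0. \<forall>t x. 0 < t \<longrightarrow> t \<le> t0 \<longrightarrow> norm x \<le> 1 \<longrightarrow> norm R - t < norm (blinfun_apply R x) \<longrightarrow>
      norm f2 - 2 * t \<le> norm (blinfun_apply f2 x)"
proof -
  define \<mu> where "\<mu> = norm f2"
  let ?k = "\<lambda>y. blinfun_apply y (blinfun_apply F e)"
  let ?S = "adjoint_op S" and ?F = "adjoint_op F"
  define V1 where "V1 = {f \<in> \<Gamma>. norm (?F f) + (1 - \<delta>) * norm (f - ?F f) \<le> 1}"
  have Fe: "norm (blinfun_apply F e) = 1" and F1: "norm F = 1" and y1Fe: "?k y1 = 1" and Fy1: "?F y1 = y1"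
    and out: "\<And>f. f \<in> \<Gamma> - V1 \<Longrightarrow> norm (?k f) \<le> \<rho> y1"
    and hull: "\<And>f. f \<in> \<Gamma> \<Longrightarrow> infdist (?F f) (absolutely_convex hull ({0} \<union> V)) < \<delta>"
    and Ve: "\<And>f. f \<in> V \<Longrightarrow> norm (blinfun_apply f e - 1) \<le> \<delta>"
    using wit unfolding quasi_ACK_witness_def Let_def V1_def by blast+
  have outside: "norm (?k f) \<le> r" if "f \<in> \<Gamma> - V1" for f
    using out[OF that] \<rho> by linarith
  have \<Gamma>: "\<Gamma> \<subseteq> dual_ball sY" by (rule Y.one_norming_subset[OF norming])
  have \<Gamma>1: "norm y \<le> 1" and \<Gamma>d: "y \<in> dual sY" if "y \<in> \<Gamma>" for y
    using that \<Gamma> by (auto simp: dual_ball_def)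
  have "0 < \<eta> * (1 - r) * m" using \<eta> r m by simp
  then have \<delta>0: "0 < \<delta>" using \<delta> m by (smt (verit) zero_less_mult_pos2)
  have "\<eta> * (1 - r) * m \<le> \<eta> * 1 * m" using \<eta> r m by (intro mult_right_mono mult_left_mono) auto
  then have \<delta>\<eta>: "5 * \<delta> + 3 * (m * \<delta>) \<le> \<eta> * m" using \<delta> by (simp add: algebra_simps)
  have m\<delta>: "0 < m * \<delta>" using m \<delta>0 by simp
  have "\<eta> * m \<le> m" using \<eta> m by simp
  have \<delta>1: "\<delta> < 1" 
  proof -
    have "3 * (m * \<delta>) < m * 1" using \<delta>\<eta> \<open>\<eta> * m \<le> m\<close> \<delta>0 by linarith
    then have "m * (3 * \<delta>) < m * 1" by simp
    then have "3 * \<delta> < 1" using m mult_less_cancel_left_pos by blast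
    then show ?thesis using \<delta>0 by simp
  qed
  have f1m: "norm f1 \<le> m"
    using norm_adjoint_le[of S y1] \<Gamma>1[of y1] V m unfolding f1_def m_def
    by (meson mult_left_le norm_ge_zero order_trans subsetD)
  have \<mu>: "m - 2 * \<delta> \<le> \<mu>"
    using norm_triangle_ineq2[of f1 "f1 - f2"] f1 f2 unfolding \<mu>_def by (simp add: norm_minus_commute)
  have \<mu>0: "0 < \<mu>" using \<mu> \<delta>\<eta> \<open>\<eta> * m \<le> m\<close> m\<delta> \<delta>0 by linarith
  then show "f2 \<noteq> 0" by (auto simp: \<mu>_def)
  have k: "norm (?k y) \<le> 1" and kF: "?k y = blinfun_apply (?F y) e" and Fy: "norm (?F y) \<le> 1"
    and Sy: "norm (?S y) \<le> m" and SF: "norm (?S (?F y)) \<le> m" if "y \<in> \<Gamma>" for y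
  proof -
    have y: "norm y \<le> 1" using \<Gamma>1[OF that] .
    show "norm (?k y) \<le> 1"
      using norm_dual_ball_apply_le[of y sY "blinfun_apply F e"] that \<Gamma> Fe by auto
    show "?k y = blinfun_apply (?F y) e" by (simp add: apply_adjoint)
    show Fy: "norm (?F y) \<le> 1" using norm_adjoint_le[of F y] F1 y by simp
    have "norm (?S z) \<le> m" if "norm z \<le> 1" for z :: "'y \<Rightarrow>\<^sub>L 'k"
      using norm_adjoint_le[of S z] that unfolding m_def by (meson mult_left_le norm_ge_zero order_trans)
    then show "norm (?S y) \<le> m" "norm (?S (?F y)) \<le> m" using y Fy by auto
  qed
  \<comment> \<open>The error of the approximation of \<open>S\<^sup>* (F\<^sup>* y)\<close> by a multiple of \<open>f1\<close>.\<close>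
  define E where "E y = ?S (?F y) - scale_functional (?k y) f1" for y
  have E: "norm (E y) \<le> \<delta> + 3 * (m * \<delta>)" if y: "y \<in> \<Gamma>" for y
  proof -
    let ?H = "absolutely_convex hull ({0} \<union> V)"
    have "0 \<in> ?H" by (rule hull_inc) simp
    then obtain g where g: "g \<in> ?H" "norm (?F y - g) < \<delta>"
      using infdist_less_witness[OF hull[OF y]] by (auto simp: dist_norm)
    have on_V: "norm (?S v - scale_functional (blinfun_apply v e) f1) \<le> \<delta> + m * \<delta>" if v: "v \<in> V" for v
    proof -
      have "?S v - scale_functional (blinfun_apply v e) f1
          = (?S v - f1) - scale_functional (blinfun_apply v e - 1) f1"
        by (simp add: scale_functional_diff_left scale_functional_one)
      also have "norm \<dots> \<le> norm (?S v - f1) + norm (blinfun_apply v e - 1) * norm f1"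
        by (meson norm_triangle_ineq4 norm_scale_functional_le add_left_mono order_trans)
      also have "\<dots> \<le> \<delta> + \<delta> * m"
        using diam[OF v] Ve[OF v] f1m \<delta>0 by (intro add_mono mult_mono) auto
      finally show ?thesis by (simp add: mult.commute)
    qed
    have "norm (?S g - scale_functional (blinfun_apply g e) f1) \<le> \<delta> + m * \<delta>"
      by (rule adjoint_near_rank_one_on_hull[OF on_V _ g(1)]) (use \<delta>0 m\<delta> in simp_all)
    moreover have "norm (?S (?F y - g)) \<le> m * \<delta>"
      using norm_adjoint_le[of S "?F y - g"] g(2) m unfolding m_def
      by (meson less_imp_le mult_left_mono norm_ge_zero order_trans)
    moreover have "norm (scale_functional (blinfun_apply (?F y - g) e) f1) \<le> \<delta> * m"
    proof -
      have "norm (blinfun_apply (?F y - g) e) \<le> \<delta>"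
        using norm_blinfun[of "?F y - g" e] e g(2) by simp
      then have "norm (blinfun_apply (?F y - g) e) * norm f1 \<le> \<delta> * m"
        using f1m \<delta>0 by (intro mult_mono) auto
      then show ?thesis using norm_scale_functional_le order_trans by blast
    qed
    moreover have "E y = ?S (?F y - g) + (?S g - scale_functional (blinfun_apply g e) f1)
        - scale_functional (blinfun_apply (?F y - g) e) f1"
      unfolding E_def kF[OF y] blinfun.diff_left scale_functional_diff_left adjoint_diff by simp
    ultimately show ?thesis
      using norm_triangle_ineq4[of "?S (?F y - g) + (?S g - scale_functional (blinfun_apply g e) f1)"
          "scale_functional (blinfun_apply (?F y - g) e) f1"]
        norm_triangle_ineq[of "?S (?F y - g)" "?S g - scale_functional (blinfun_apply g e) f1"]
      by (simp add: mult.commute)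
  qed
  define L where "L y = scale_functional (?k y) (f2 - f1)" for y
  have L: "norm (L y) \<le> \<delta>" if "y \<in> \<Gamma>" for y
    using norm_scale_functional_le[of "?k y" "f2 - f1"] k[OF that] f2 mult_right_mono[of "norm (?k y)" 1 "norm (f2 - f1)"]
    unfolding L_def by simp
  have Radj: "adjoint_op R y = scale_functional (?k y) f2 + (1 - \<eta>) *\<^sub>R (?S y - ?S (?F y))" if "y \<in> \<Gamma>" for y
    using Y.apply_dual_scale[OF \<Gamma>d[OF that]]
    by (intro blinfun_eqI) (simp add: R apply_adjoint blinfun.add_left blinfun.add_right blinfun.diff_left
      blinfun.diff_right blinfun.scaleR_left blinfun.scaleR_right Y.rank_one_apply scale_functional_apply)
  have RS: "adjoint_op (R - S) y = adjoint_op R y - ?S y" for y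
    using adjoint_add[of "R - S" S y] by (simp add: algebra_simps)
  have norm4: "norm (a - b + c - d) \<le> norm a + norm b + norm c + norm d" for a b c d :: "'x \<Rightarrow>\<^sub>L 'k"
    using norm_triangle_ineq4[of "a - b + c" d] norm_triangle_ineq[of "a - b" c] norm_triangle_ineq4[of a b]
    by linarith
  have norm4': "norm (a + b + c - d) \<le> norm a + norm b + norm c + norm d" for a b c d :: "'x \<Rightarrow>\<^sub>L 'k"
    using norm4[of a "- b" c d] by simp
  show "norm (R - S) \<le> 3 * \<eta> * m"
  proof (rule norm_le_by_norming[OF norming])
    fix y assume y: "y \<in> \<Gamma>"
    have "adjoint_op (R - S) y = L y - E y + \<eta> *\<^sub>R ?S (?F y) - \<eta> *\<^sub>R ?S y"
      unfolding RS Radj[OF y] L_def E_def scale_functional_diff by (simp add: algebra_simps)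
    also have "norm \<dots> \<le> norm (L y) + norm (E y) + norm (\<eta> *\<^sub>R ?S (?F y)) + norm (\<eta> *\<^sub>R ?S y)"
      by (rule norm4)
    also have "\<dots> = norm (L y) + norm (E y) + \<eta> * norm (?S (?F y)) + \<eta> * norm (?S y)"
      using \<eta> by simp
    also have "\<dots> \<le> \<delta> + (\<delta> + 3 * (m * \<delta>)) + \<eta> * m + \<eta> * m"
      using L[OF y] E[OF y] Sy[OF y] SF[OF y] \<eta> by (intro add_mono mult_left_mono) auto
    also have "\<dots> \<le> 3 * \<eta> * m" using \<delta>\<eta> \<delta>0 by simp
    finally show "norm (adjoint_op (R - S) y) \<le> 3 * \<eta> * m" .
  qed
  have far: "norm (adjoint_op R y) \<le> \<mu> - \<delta>" if y: "y \<in> \<Gamma>" "y \<notin> V1" for y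
  proof -
    have "adjoint_op R y = (1 - \<eta>) *\<^sub>R ?S y + L y + \<eta> *\<^sub>R scale_functional (?k y) f1 - (1 - \<eta>) *\<^sub>R E y"
      unfolding Radj[OF y(1)] L_def E_def scale_functional_diff by (simp add: algebra_simps)
    also have "norm \<dots> \<le> norm ((1 - \<eta>) *\<^sub>R ?S y) + norm (L y) + norm (\<eta> *\<^sub>R scale_functional (?k y) f1)
        + norm ((1 - \<eta>) *\<^sub>R E y)"
      by (rule norm4')
    also have "\<dots> = (1 - \<eta>) * norm (?S y) + norm (L y) + \<eta> * norm (scale_functional (?k y) f1)
        + (1 - \<eta>) * norm (E y)"
      using \<eta> by simp
    also have "\<dots> \<le> (1 - \<eta>) * m + \<delta> + \<eta> * (r * m) + 1 * (\<delta> + 3 * (m * \<delta>))"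
    proof (intro add_mono mult_left_mono mult_mono)
      show "norm (scale_functional (?k y) f1) \<le> r * m"
        using norm_scale_functional_le[of "?k y" f1] outside[of y] y f1m r
        by (meson DiffI mult_mono norm_ge_zero order_trans)
    qed (use \<eta> L[OF y(1)] E[OF y(1)] Sy[OF y(1)] in auto)
    also have "\<dots> = m - \<delta> * (5 + 3 * m) + 2 * \<delta> + 3 * (m * \<delta>)"
      unfolding \<delta> by (simp add: algebra_simps)
    also have "\<dots> \<le> \<mu> - \<delta>" using \<mu> by (simp add: algebra_simps)
    finally show ?thesis .
  qed
  \<comment> \<open>The factor \<open>q < 1\<close> is room to spare in the estimate on \<open>V1\<close>; it is what excludes that a small
    \<open>norm (F\<^sup>* y)\<close> is compensated by a large \<open>norm (y - F\<^sup>* y)\<close>.\<close>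
  define q where "q = 1 - \<eta> / 2"
  have q: "0 < q" "q < 1" using \<eta> by (auto simp: q_def)
  have slack: "(1 - \<eta>) * m \<le> \<mu> * q * (1 - \<delta>)"
  proof -
    define w where "w = q * (1 - \<delta>)"
    have w: "0 \<le> w" "w \<le> 1" using q \<delta>0 \<delta>1 unfolding w_def by (auto intro: mult_le_one)
    have "1 - \<eta> / 2 - \<delta> \<le> w" using \<eta> \<delta>0 unfolding w_def q_def by (simp add: algebra_simps)
    then have "m * (1 - \<eta> / 2 - \<delta>) \<le> m * w" using m by simp
    then have "m - \<eta> * m / 2 - m * \<delta> \<le> m * w"
      by (simp add: right_diff_distrib mult.commute)
    moreover have "\<delta> * w \<le> \<delta>" using w \<delta>0 by simp
    ultimately have "m - \<eta> * m \<le> m * w - 2 * (\<delta> * w)"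
      using \<delta>\<eta> m\<delta> \<delta>0 by argo
    then have "(1 - \<eta>) * m \<le> (m - 2 * \<delta>) * w"
      by (simp add: left_diff_distrib)
    also have "\<dots> \<le> \<mu> * w" using \<mu> w by (intro mult_right_mono)
    finally show ?thesis by (simp add: w_def mult.assoc)
  qed
  have inside: "norm (adjoint_op R y) \<le> \<mu>"
    and inside_apply: "\<And>x. norm x \<le> 1 \<Longrightarrow> norm (blinfun_apply (adjoint_op R y) x)
      \<le> norm (?F y) * norm (blinfun_apply f2 x) + \<mu> * q * (1 - norm (?F y))" if y: "y \<in> V1" for y
  proof -
    have y\<Gamma>: "y \<in> \<Gamma>" using y by (simp add: V1_def)
    let ?a = "norm (?F y)"
    let ?G = "(1 - \<eta>) *\<^sub>R (?S y - ?S (?F y))"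
    have ka: "norm (?k y) \<le> ?a"
      unfolding kF[OF y\<Gamma>] using norm_blinfun[of "?F y" e] e by simp
    have "norm (?S y - ?S (?F y)) \<le> m * norm (y - ?F y)"
      using norm_adjoint_le[of S "y - ?F y"] unfolding m_def adjoint_diff .
    then have "norm ?G \<le> (1 - \<eta>) * m * norm (y - ?F y)"
      using \<eta> mult_left_mono[of "norm (?S y - ?S (?F y))" "m * norm (y - ?F y)" "1 - \<eta>"] by (simp add: mult.assoc)
    also have "\<dots> \<le> \<mu> * q * (1 - \<delta>) * norm (y - ?F y)"
      using slack by (intro mult_right_mono) auto
    also have "\<dots> = \<mu> * q * ((1 - \<delta>) * norm (y - ?F y))" by simp
    also have "\<dots> \<le> \<mu> * q * (1 - ?a)"
      using y \<mu>0 q by (intro mult_left_mono) (auto simp: V1_def)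
    finally have G: "norm ?G \<le> \<mu> * q * (1 - ?a)" .
    show "norm (blinfun_apply (adjoint_op R y) x) \<le> ?a * norm (blinfun_apply f2 x) + \<mu> * q * (1 - ?a)"
      if x: "norm x \<le> 1" for x
    proof -
      have "norm (blinfun_apply (adjoint_op R y) x) \<le> norm (?k y) * norm (blinfun_apply f2 x) + norm (blinfun_apply ?G x)"
        unfolding Radj[OF y\<Gamma>] blinfun.add_left scale_functional_apply
        by (metis norm_mult norm_triangle_ineq)
      also have "\<dots> \<le> ?a * norm (blinfun_apply f2 x) + norm ?G"
        using ka by (intro add_mono mult_right_mono norm_apply_le_ball x) auto
      finally show ?thesis using G by linarith
    qed
    have "norm (adjoint_op R y) \<le> norm (?k y) * \<mu> + norm ?G"
      unfolding Radj[OF y\<Gamma>] \<mu>_def by (intro norm_triangle_mono norm_scale_functional_le order_refl)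
    also have "\<dots> \<le> ?a * \<mu> + \<mu> * q * (1 - ?a)"
      using ka G \<mu>0 by (intro add_mono mult_right_mono) auto
    also have "\<dots> \<le> ?a * \<mu> + \<mu> * 1 * (1 - ?a)"
      using q \<mu>0 Fy[OF y\<Gamma>] by (intro add_mono mult_right_mono mult_left_mono) auto
    also have "\<dots> = \<mu>" by (simp add: algebra_simps)
    finally show "norm (adjoint_op R y) \<le> \<mu>" .
  qed
  have R\<mu>: "norm R \<le> \<mu>"
    by (rule norm_le_by_norming[OF norming]) (use far inside \<delta>0 in fastforce)
  have y1\<Gamma>: "y1 \<in> \<Gamma>" using V by blast
  have Ry1: "adjoint_op R y1 = f2"
    unfolding Radj[OF y1\<Gamma>] y1Fe Fy1 by (simp add: scale_functional_one)
  show f2R: "norm (blinfun_apply f2 x) \<le> norm (blinfun_apply R x)" for x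
    using norm_dual_ball_apply_le[of y1 sY "blinfun_apply R x"] y1\<Gamma> \<Gamma>
    by (subst Ry1[symmetric]) (auto simp: apply_adjoint)
  have "\<mu> \<le> norm R"
    unfolding \<mu>_def using f2R norm_blinfun[of R] by (intro norm_blinfun_bound) (auto intro: order_trans)
  with R\<mu> show normR: "norm R = norm f2" by (simp add: \<mu>_def)
  show "\<exists>t0>0. \<forall>t x. 0 < t \<longrightarrow> t \<le> t0 \<longrightarrow> norm x \<le> 1 \<longrightarrow> norm R - t < norm (blinfun_apply R x) \<longrightarrow>
      norm f2 - 2 * t \<le> norm (blinfun_apply f2 x)"
  proof (intro exI[of _ "min \<delta> ((1 - q) * \<mu> / 2)"] conjI allI impI)
    show "0 < min \<delta> ((1 - q) * \<mu> / 2)" using \<delta>0 q \<mu>0 by simp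
    fix t x assume t: "0 < t" "t \<le> min \<delta> ((1 - q) * \<mu> / 2)" and x: "norm x \<le> 1"
      and Rx: "norm R - t < norm (blinfun_apply R x)"
    obtain y where y: "y \<in> \<Gamma>" "\<mu> - t < norm (blinfun_apply y (blinfun_apply R x))"
      using Y.one_norming_witness[OF norming Rx] by (auto simp: normR \<mu>_def)
    have "y \<in> V1"
    proof (rule ccontr)
      assume "y \<notin> V1"
      then have "norm (blinfun_apply (adjoint_op R y) x) \<le> \<mu> - \<delta>"
        using far[OF y(1)] norm_apply_le_ball[OF x] order_trans by blast
      then show False using y(2) t by (simp add: apply_adjoint)
    qed
    define a b where "a = norm (?F y)" and "b = norm (blinfun_apply f2 x)"
    have a: "0 \<le> a" "a \<le> 1" using Fy[OF y(1)] by (auto simp: a_def)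
    have b: "b \<le> \<mu>" unfolding b_def \<mu>_def by (rule norm_apply_le_ball[OF x])
    have main: "\<mu> - t < a * b + \<mu> * q * (1 - a)"
      using inside_apply[OF \<open>y \<in> V1\<close> x] y(2) unfolding a_def b_def by (simp add: apply_adjoint)
    have "a * b \<le> a * \<mu>" using a b by (intro mult_left_mono)
    then have "(1 - q) * \<mu> * (1 - a) < t" using main by (simp add: algebra_simps)
    also have "t \<le> (1 - q) * \<mu> * (1/2)" using t by simp
    finally have "1 - a < 1/2" using q \<mu>0 by (subst (asm) mult_less_cancel_left_pos) auto
    moreover have "\<mu> * q * (1 - a) \<le> \<mu> * 1 * (1 - a)"
      using q \<mu>0 a by (intro mult_right_mono mult_left_mono) auto
    then have "a * (\<mu> - b) \<le> t" using main by (simp add: algebra_simps)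
    moreover have "1/2 * (\<mu> - b) \<le> a * (\<mu> - b)" if "1 - a < 1/2"
      using that b by (intro mult_right_mono) auto
    ultimately show "norm f2 - 2 * t \<le> norm (blinfun_apply f2 x)"
      unfolding \<mu>_def b_def by fastforce
  qed
qed

end

section \<open>Approximation by operators controlled by one functional\<close>

context K_banach_pair
begin

text \<open>The norm of \<open>adjoint_op S e'\<close> is exactly that of \<open>S\<close>, so \<open>\<delta>\<close> may be chosen in terms of the bound
  \<open>r\<close> belonging to \<open>e'\<close>: for every \<open>\<delta>\<close> some vector has an image that \<open>e'\<close> norms up to \<open>\<delta>\<close>, and
  then, as \<open>e'\<close> lies in the closure, so do the functionals in a nonempty open part \<open>U0\<close> of \<open>\<Gamma>'\<close>.\<close>

lemma exists_controlled_operator: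
  assumes norming: "one_norming sY \<Gamma>" and S: "S \<in> K_operators sX sY" "S \<noteq> 0"
    and \<Gamma>': "\<Gamma>' \<subseteq> \<Gamma>" and r: "0 \<le> r" "r < 1" and \<rho>: "\<And>y. y \<in> \<Gamma>' \<Longrightarrow> \<rho> y \<le> r"
    and flat: "flat_operator sY \<Gamma>' S"
    and attain: "norm (adjoint_op S e') = norm S"
    and e': "e' \<in> weak_star sY closure_of {scale_functional \<theta> f | \<theta> f. norm \<theta> = 1 \<and> f \<in> \<Gamma>'}"
    and wit: "\<And>\<epsilon> U. 0 < \<epsilon> \<Longrightarrow> openin (subtopology (weak_star sY) \<Gamma>') U \<Longrightarrow> U \<noteq> {} \<Longrightarrow>
      \<exists>V y1 e F. V \<subseteq> U \<and> y1 \<in> V \<and> e \<in> sphere 0 1 \<and> F \<in> K_operators sY sY \<and>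
        quasi_ACK_witness sY \<Gamma> \<rho> \<epsilon> V y1 e F"
    and D: "D \<subseteq> dual sX" "dual sX \<subseteq> closure D" and "\<epsilon> > 0"
  shows "\<exists>R\<in>K_operators sX sY. \<exists>f\<in>D. norm (R - S) < \<epsilon> \<and> f \<noteq> 0 \<and> norm R = norm f \<and>
    (\<forall>x. norm (blinfun_apply f x) \<le> norm (blinfun_apply R x)) \<and>
    (\<exists>t0>0. \<forall>t x. 0 < t \<longrightarrow> t \<le> t0 \<longrightarrow> norm x \<le> 1 \<longrightarrow> norm R - t < norm (blinfun_apply R x) \<longrightarrow>
      norm f - 2 * t \<le> norm (blinfun_apply f x))"
proof -
  define m where "m = norm S"
  have m: "0 < m" using S by (simp add: m_def)
  define \<eta> where "\<eta> = min (1/2) (\<epsilon> / (6 * m))"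
  have \<eta>: "0 < \<eta>" "\<eta> < 1" using m \<open>\<epsilon> > 0\<close> by (auto simp: \<eta>_def)
  have "\<eta> * (6 * m) \<le> \<epsilon> / (6 * m) * (6 * m)"
    using m by (intro mult_right_mono) (auto simp: \<eta>_def)
  then have \<eta>\<epsilon>: "3 * \<eta> * m < \<epsilon>" using m \<open>\<epsilon> > 0\<close> by simp
  define \<delta> where "\<delta> = \<eta> * (1 - r) * m / (5 + 3 * m)"
  have \<delta>: "\<delta> * (5 + 3 * m) = \<eta> * (1 - r) * m" using m by (simp add: \<delta>_def)
  have \<delta>0: "0 < \<delta>" using m \<eta> r by (simp add: \<delta>_def)
  obtain x where x: "norm x \<le> 1" "m - \<delta> < norm (blinfun_apply e' (blinfun_apply S x))"
    using almost_norming_vector[OF \<delta>0, of "adjoint_op S e'"] attain by (auto simp: m_def apply_adjoint)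
  define W where "W = {w::'k. m - \<delta> < norm w}"
  have "open W" unfolding W_def by (intro open_Collect_less continuous_intros)
  let ?T = "subtopology (weak_star sY) \<Gamma>'"
  define U0 where "U0 = {y \<in> topspace ?T. blinfun_apply y (blinfun_apply S x) \<in> W}"
  have U0: "openin ?T U0"
    unfolding U0_def by (rule openin_weak_star_slice[OF openin_topspace \<open>open W\<close>])
  define W' where "W' = {y \<in> topspace (weak_star sY). blinfun_apply y (blinfun_apply S x) \<in> W}"
  have "openin (weak_star sY) W'"
    using continuous_map_weak_star[of sY "blinfun_apply S x"] \<open>open W\<close>
    by (simp add: W'_def continuous_map_def)
  moreover have "e' \<in> W'"
    using e' x by (simp add: W'_def W_def in_closure_of)
  ultimately obtain y where y: "y \<in> {scale_functional \<theta> f | \<theta> f. norm \<theta> = 1 \<and> f \<in> \<Gamma>'}" "y \<in> W'"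
    using in_closure_of[THEN iffD1, OF e', THEN conjunct2, rule_format, of W'] by auto
  then obtain \<theta> f where f: "norm \<theta> = 1" "f \<in> \<Gamma>'" "blinfun_apply (scale_functional \<theta> f) (blinfun_apply S x) \<in> W"
    unfolding W'_def by auto
  have "f \<in> dual sY"
    using subsetD[OF Y.one_norming_subset[OF norming] subsetD[OF \<Gamma>' f(2)]] by (simp add: dual_ball_def)
  moreover have "blinfun_apply f (blinfun_apply S x) \<in> W"
    using f(1,3) by (simp add: W_def scale_functional_apply norm_mult)
  ultimately have "f \<in> U0"
    using f(2) by (simp add: U0_def topspace_weak_star)
  then obtain U where U: "U \<subseteq> U0" "openin ?T U" "U \<noteq> {}"
      "\<forall>p\<in>U. \<forall>q\<in>U. dist (adjoint_op S p) (adjoint_op S q) < \<delta>"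
    using flat[unfolded flat_operator_def openly_fragmented_iff, rule_format, of U0 \<delta>] U0 \<delta>0 by auto
  obtain V y1 e F where V: "V \<subseteq> U" "y1 \<in> V" "e \<in> sphere 0 1" "F \<in> K_operators sY sY"
      "quasi_ACK_witness sY \<Gamma> \<rho> \<delta> V y1 e F"
    using wit[OF \<delta>0 U(2,3)] by blast
  have y1: "y1 \<in> U0" "y1 \<in> \<Gamma>'" "y1 \<in> dual sY"
    using V U by (auto simp: U0_def topspace_weak_star)
  have V\<Gamma>: "V \<subseteq> \<Gamma>" using V(1) U(1) \<Gamma>' by (auto simp: U0_def)
  have f1: "m - \<delta> < norm (adjoint_op S y1)"
    using y1(1) norm_apply_le_ball[OF x(1), of "adjoint_op S y1"]
    by (auto simp: U0_def W_def apply_adjoint)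
  have "adjoint_op S y1 \<in> closure D"
    using adjoint_dual[OF S(1) y1(3)] D(2) by blast
  then obtain f2 where f2: "f2 \<in> D" "norm (f2 - adjoint_op S y1) < \<delta>"
    using \<delta>0 unfolding closure_approachable dist_norm by blast
  define R where "R = rank_one sY f2 (blinfun_apply F e) + (1 - \<eta>) *\<^sub>R (S - (F o\<^sub>L S))"
  have RK: "R \<in> K_operators sX sY"
    unfolding R_def using S V(4) f2(1) D(1)
    by (intro K_operators_add K_operators_rank_one K_operators_scaleR K_operators_diff K_operators_compose) auto
  have diam: "norm (adjoint_op S v - adjoint_op S y1) \<le> \<delta>" if "v \<in> V" for v
    using U(4) V(1,2) that by (metis dist_norm less_imp_le subsetD)
  have e: "norm e = 1" using V(3) by simp
  note est = modified_operator_estimates[OF norming m[unfolded m_def] \<eta> r \<delta>[unfolded m_def] V\<Gamma> V(2) e V(5)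
      \<rho>[OF y1(2)] diam f1[unfolded m_def] f2(2) R_def]
  have "norm (R - S) < \<epsilon>" using est(1) \<eta>\<epsilon> by (simp add: m_def)
  then show ?thesis using RK f2(1) est(2-5) by blast
qed

text \<open>The iteration needs a nonzero operator to start from; if \<open>T\<close> is zero, a small rank-one operator
  takes its place, for which some nonzero functional \<open>g\<close> is required.\<close>

lemma flat_operators_approximable:
  assumes ACK: "quasi_ACK sY \<Gamma> \<rho>" and T: "T \<in> K_operators sX sY"
    and flat: "\<And>\<Gamma>\<^sub>0. \<Gamma>\<^sub>0 \<subseteq> \<Gamma> \<Longrightarrow> flat_operator sY \<Gamma>\<^sub>0 T"
    and D: "D \<subseteq> dual sX" "dual sX \<subseteq> closure D" and g: "g \<in> dual sX" "g \<noteq> 0" and "\<epsilon> > 0"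
  shows "\<exists>R\<in>K_operators sX sY. \<exists>f\<in>D. norm (R - T) < \<epsilon> \<and> f \<noteq> 0 \<and> norm R = norm f \<and>
    (\<forall>x. norm (blinfun_apply f x) \<le> norm (blinfun_apply R x)) \<and>
    (\<exists>t0>0. \<forall>t x. 0 < t \<longrightarrow> t \<le> t0 \<longrightarrow> norm x \<le> 1 \<longrightarrow> norm R - t < norm (blinfun_apply R x) \<longrightarrow>
      norm f - 2 * t \<le> norm (blinfun_apply f x))"
proof -
  have norming: "one_norming sY \<Gamma>" and \<rho>01: "\<And>y. y \<in> \<Gamma> \<Longrightarrow> 0 \<le> \<rho> y \<and> \<rho> y < 1"
    using ACK unfolding quasi_ACK_def by blast+
  have \<Gamma>: "\<Gamma> \<subseteq> dual_ball sY" by (rule Y.one_norming_subset[OF norming])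
  define \<G> where "\<G> = K_operators sX sY \<inter> (\<Inter>\<Gamma>\<^sub>0\<in>Pow \<Gamma>. {A. flat_operator sY \<Gamma>\<^sub>0 A})"
  have closed: "closed \<G>"
    unfolding \<G>_def using \<Gamma>
    by (intro closed_Int closed_K_operators closed_INT ballI Y.closed_flat_operators) auto
  have rank_one: "A + rank_one sY f z \<in> \<G>" if "A \<in> \<G>" "f \<in> dual sX" for A f z
    using that unfolding \<G>_def
    by (auto intro: K_operators_add K_operators_rank_one Y.flat_operator_add_rank_one)
  have TG: "T \<in> \<G>" using T flat by (auto simp: \<G>_def)
  have "\<exists>T'\<in>\<G>. T' \<noteq> 0 \<and> norm (T' - T) < \<epsilon> / 3"
  proof (cases "T = 0")
    case True
    obtain z :: 'y where z: "z \<noteq> 0" using Y.nonzero by blast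
    obtain x where x: "blinfun_apply g x \<noteq> 0"
      using g(2) by (metis blinfun_eqI zero_blinfun.rep_eq)
    define s where "s = \<epsilon> / (6 * (norm g * norm z))"
    have gz: "0 < norm g * norm z" using g z by simp
    then have s: "0 < s" using \<open>\<epsilon> > 0\<close> by (simp add: s_def)
    have "norm (rank_one sY (s *\<^sub>R g) z) \<le> s * (norm g * norm z)"
      using Y.norm_rank_one_le[of "s *\<^sub>R g" z] s by (simp add: mult.assoc)
    also have "\<dots> = \<epsilon> / 6" using g z by (simp add: s_def)
    also have "\<dots> < \<epsilon> / 3" using \<open>\<epsilon> > 0\<close> by simp
    finally have "norm (T + rank_one sY (s *\<^sub>R g) z - T) < \<epsilon> / 3" by simp
    moreover have "norm (blinfun_apply (T + rank_one sY (s *\<^sub>R g) z) x) \<noteq> 0"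
      using True s x z
      by (simp only: blinfun.add_left Y.rank_one_apply blinfun.scaleR_left Y.norm_scale) (simp add: Y.norm_scale)
    then have "T + rank_one sY (s *\<^sub>R g) z \<noteq> 0"
      by (metis norm_zero zero_blinfun.rep_eq)
    ultimately show ?thesis
      using rank_one[OF TG dual_scaleR[OF g(1)]] by blast
  qed (use TG \<open>\<epsilon> > 0\<close> in auto)
  then obtain T' where T': "T' \<in> \<G>" "T' \<noteq> 0" "norm (T' - T) < \<epsilon> / 3" by blast
  have "min (\<epsilon> / 3) (norm T' / 2) > 0" using T' \<open>\<epsilon> > 0\<close> by simp
  then obtain S e where S: "S \<in> \<G>" "norm (S - T') \<le> min (\<epsilon> / 3) (norm T' / 2)"
      and e: "e extreme_point_of dual_ball sY" "norm (adjoint_op S e) = norm S"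
    using adjoint_attains_norm_at_extreme_point[OF norming _ closed rank_one T'(1,2)] unfolding \<G>_def by blast
  have "S \<noteq> 0"
    using S(2) T'(2) by auto
  obtain \<Gamma>' where \<Gamma>': "\<Gamma>' \<subseteq> \<Gamma>"
      and cl: "e \<in> weak_star sY closure_of {scale_functional \<theta> f | \<theta> f. norm \<theta> = 1 \<and> f \<in> \<Gamma>'}"
      and sup: "(SUP f \<in> \<Gamma>'. \<rho> f) < 1"
      and wit: "\<And>\<epsilon> U. 0 < \<epsilon> \<Longrightarrow> openin (subtopology (weak_star sY) \<Gamma>') U \<and> U \<noteq> {} \<Longrightarrow>
          (\<exists>V y1 e F. V \<subseteq> U \<and> V \<noteq> {} \<and> y1 \<in> V \<and> e \<in> sphere 0 1 \<and> F \<in> K_operators sY sY \<and>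
            quasi_ACK_witness sY \<Gamma> \<rho> \<epsilon> V y1 e F)"
    using ACK e(1) unfolding quasi_ACK_def by meson
  have "bdd_above (\<rho> ` \<Gamma>')"
    using \<Gamma>' \<rho>01 by (intro bdd_aboveI2[of _ _ 1]) (meson less_imp_le subsetD)
  then have \<rho>: "\<rho> y \<le> (SUP f \<in> \<Gamma>'. \<rho> f)" if "y \<in> \<Gamma>'" for y
    using that by (rule cSUP_upper[rotated])
  have "\<Gamma>' \<noteq> {}" using cl by auto
  then have sup0: "0 \<le> (SUP f \<in> \<Gamma>'. \<rho> f)"
    using \<rho> \<rho>01 \<Gamma>' by (meson all_not_in_conv order_trans subsetD)
  have SK: "S \<in> K_operators sX sY" and flatS: "flat_operator sY \<Gamma>' S"
    using S(1) \<Gamma>' by (auto simp: \<G>_def)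
  have wit': "\<exists>V y1 e F. V \<subseteq> U \<and> y1 \<in> V \<and> e \<in> sphere 0 1 \<and> F \<in> K_operators sY sY \<and>
      quasi_ACK_witness sY \<Gamma> \<rho> \<epsilon> V y1 e F"
    if "0 < \<epsilon>" "openin (subtopology (weak_star sY) \<Gamma>') U" "U \<noteq> {}" for \<epsilon> U
    using wit[OF that(1)] that(2,3) by meson
  have "0 < \<epsilon> / 3" using \<open>\<epsilon> > 0\<close> by simp
  from exists_controlled_operator[OF norming SK \<open>S \<noteq> 0\<close> \<Gamma>' sup0 sup \<rho> flatS e(2) cl wit' D this]
  obtain R f where R: "R \<in> K_operators sX sY" "f \<in> D" "norm (R - S) < \<epsilon> / 3" "f \<noteq> 0" "norm R = norm f"
      "\<forall>x. norm (blinfun_apply f x) \<le> norm (blinfun_apply R x)"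
      "\<exists>t0>0. \<forall>t x. 0 < t \<longrightarrow> t \<le> t0 \<longrightarrow> norm x \<le> 1 \<longrightarrow> norm R - t < norm (blinfun_apply R x) \<longrightarrow>
        norm f - 2 * t \<le> norm (blinfun_apply f x)"
    by blast
  have "norm (R - T) \<le> norm (R - S) + norm (S - T') + norm (T' - T)"
    using norm_triangle_ineq[of "R - S + (S - T')" "T' - T"] norm_triangle_ineq[of "R - S" "S - T'"] by simp
  then have "norm (R - T) < \<epsilon>" using R(3) S(2) T'(3) by simp
  then show ?thesis using R by blast
qed

end

section \<open>Maximizing sequences of a functional\<close>

context K_banach
begin

lemma tendsto_scale:
  assumes "\<psi> \<longlonglongrightarrow> \<theta>" "u \<longlonglongrightarrow> x"
  shows "(\<lambda>n. scale (\<psi> n) (u n)) \<longlonglongrightarrow> scale \<theta> x"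
proof (rule LIM_zero_cancel, rule Lim_null_comparison)
  have "norm (scale \<theta> x - scale (\<psi> n) (u n)) \<le> norm (\<theta> - \<psi> n) * norm (u n) + norm \<theta> * norm (x - u n)" for n
  proof -
    have "scale \<theta> x - scale (\<psi> n) (u n) = scale (\<theta> - \<psi> n) (u n) + scale \<theta> (x - u n)"
      unfolding scale_left_diff_distrib scale_right_diff_distrib by simp
    then show ?thesis
      using norm_triangle_ineq[of "scale (\<theta> - \<psi> n) (u n)" "scale \<theta> (x - u n)"] by (simp add: norm_scale)
  qed
  then show "\<forall>\<^sub>F n in sequentially. norm (scale (\<psi> n) (u n) - scale \<theta> x)
      \<le> norm (\<theta> - \<psi> n) * norm (u n) + norm \<theta> * norm (x - u n)"
    by (subst norm_minus_commute) (rule always_eventually, blast)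
  have "(\<lambda>n. norm (\<theta> - \<psi> n) * norm (u n) + norm \<theta> * norm (x - u n))
      \<longlonglongrightarrow> norm (\<theta> - \<theta>) * norm x + norm \<theta> * norm (x - x)"
    by (intro tendsto_intros assms)
  then show "(\<lambda>n. norm (\<theta> - \<psi> n) * norm (u n) + norm \<theta> * norm (x - u n)) \<longlonglongrightarrow> 0"
    by simp
qed

text \<open>Multiplying each term by a phase turns a sequence that maximizes the modulus of \<open>f\<close> into one
  that maximizes its real part; the phases have a convergent subsequence.\<close>

lemma phase_aligned_subsequence:
  assumes f: "f \<in> dual scale" and xs: "\<And>n. norm (xs n) \<le> 1"
    and lim: "(\<lambda>n. norm (blinfun_apply f (xs n))) \<longlonglongrightarrow> norm f"
  shows "\<exists>\<sigma> \<theta> \<psi> u. strict_mono \<sigma> \<and> norm \<theta> = 1 \<and> \<psi> \<longlonglongrightarrow> \<theta> \<and> (\<forall>n::nat. norm (u n) \<le> 1) \<and>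
    (\<forall>n. xs (\<sigma> n) = scale (\<psi> n) (u n)) \<and> (\<lambda>n. re (blinfun_apply f (u n))) \<longlonglongrightarrow> norm f"
proof -
  obtain \<phi> where "\<forall>n. norm (\<phi> n) = 1 \<and> \<phi> n * blinfun_apply f (xs n) = of_real (norm (blinfun_apply f (xs n)))"
    using choice[OF allI[OF exists_phase], of "\<lambda>n. blinfun_apply f (xs n)"] by (elim exE) (rule that)
  then have \<phi>: "norm (\<phi> n) = 1" "\<phi> n * blinfun_apply f (xs n) = of_real (norm (blinfun_apply f (xs n)))" for n
    by auto
  obtain \<sigma> l where \<sigma>: "strict_mono \<sigma>" "norm l = 1" "(\<lambda>n. \<phi> (\<sigma> n)) \<longlonglongrightarrow> l"
    using phase_subsequence[of \<phi>, OF \<phi>(1)] by (elim exE conjE) (rule that)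
  have nz: "\<phi> n \<noteq> 0" for n using \<phi>(1)[of n] by auto
  define u where "u n = scale (\<phi> (\<sigma> n)) (xs (\<sigma> n))" for n
  have "(\<lambda>n. inverse (\<phi> (\<sigma> n))) \<longlonglongrightarrow> inverse l"
    using \<sigma> by (intro tendsto_inverse) auto
  moreover have "xs (\<sigma> n) = scale (inverse (\<phi> (\<sigma> n))) (u n)" for n
    by (simp add: u_def nz)
  moreover have "norm (u n) \<le> 1" for n
    by (simp add: u_def norm_scale \<phi> xs)
  moreover have "re (blinfun_apply f (u n)) = norm (blinfun_apply f (xs (\<sigma> n)))" for n
    by (simp add: u_def apply_dual_scale[OF f] \<phi> re_of_real)
  moreover have "(\<lambda>n. norm (blinfun_apply f (xs (\<sigma> n)))) \<longlonglongrightarrow> norm f"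
    using LIMSEQ_subseq_LIMSEQ[OF lim \<sigma>(1)] by (simp add: o_def)
  ultimately show ?thesis
    using \<sigma> by (intro exI[of _ \<sigma>] exI[of _ "inverse l"] exI[of _ "\<lambda>n. inverse (\<phi> (\<sigma> n))"] exI[of _ u])
      (auto simp: norm_inverse)
qed

lemma norm_eq_one_if_attains:
  assumes "f \<noteq> 0" "norm x \<le> 1" "re (blinfun_apply f x) = norm f"
  shows "norm x = 1"
proof -
  have "norm f * 1 \<le> norm f * norm x"
    using assms(3) re_le_norm[of "blinfun_apply f x"] norm_blinfun[of f x] by simp
  then have "1 \<le> norm x" using assms(1) mult_le_cancel_left_pos[of "norm f" 1 "norm x"] by simp
  then show ?thesis using assms(2) by simp
qed

lemma SE_maximizer:
  assumes "f \<in> SE scale"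
  shows "\<exists>x0. norm x0 = 1 \<and> re (blinfun_apply f x0) = norm f \<and>
    (\<forall>u. (\<forall>n. norm (u n) \<le> 1) \<and> (\<lambda>n. re (blinfun_apply f (u n))) \<longlonglongrightarrow> norm f \<longrightarrow> u \<longlonglongrightarrow> x0)"
proof -
  obtain x0 where f: "f \<in> dual scale" "f \<noteq> 0" and x0: "norm x0 \<le> 1"
      and sup: "re (blinfun_apply f x0) = (SUP x \<in> cball 0 1. re (blinfun_apply f x))"
      and exp: "\<forall>xs. (\<forall>n. xs n \<in> cball 0 1) \<and>
        (\<lambda>n. re (blinfun_apply f (xs n))) \<longlonglongrightarrow> re (blinfun_apply f x0) \<longrightarrow> xs \<longlonglongrightarrow> x0"
    using assms unfolding SE_def by auto
  have le: "re (blinfun_apply f x) \<le> norm f" if "norm x \<le> 1" for x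
    using re_le_norm norm_apply_le_ball[OF that] order_trans by blast
  have "norm f \<le> re (blinfun_apply f x0)"
  proof (rule ccontr)
    assume "\<not> ?thesis"
    then have "0 < norm f - re (blinfun_apply f x0)" by simp
    then obtain x where x: "norm x \<le> 1" "re (blinfun_apply f x0) < norm (blinfun_apply f x)"
      using almost_norming_vector[of "norm f - re (blinfun_apply f x0)" f] by auto
    obtain \<theta> where \<theta>: "norm \<theta> = 1" "\<theta> * blinfun_apply f x = of_real (norm (blinfun_apply f x))"
      using exists_phase by blast
    have "scale \<theta> x \<in> cball 0 1" using x \<theta> by (simp add: norm_scale)
    moreover have "bdd_above ((\<lambda>x. re (blinfun_apply f x)) ` cball 0 1)"
      using le by (intro bdd_aboveI2[of _ _ "norm f"]) auto
    ultimately have "re (blinfun_apply f (scale \<theta> x)) \<le> re (blinfun_apply f x0)"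
      unfolding sup by (rule cSUP_upper)
    then show False
      using x \<theta> by (simp add: apply_dual_scale[OF f(1)] re_of_real)
  qed
  then have eq: "re (blinfun_apply f x0) = norm f" using le[OF x0] by simp
  then show ?thesis
    using exp norm_eq_one_if_attains[OF f(2) x0 eq] by (intro exI[of _ x0]) auto
qed

text \<open>In the complex case \<open>j\<close> is the imaginary unit, in the real case \<open>0\<close> will do.\<close>

lemma exists_norm_le_re:
  "\<exists>j. \<forall>w::'k. norm w \<le> \<bar>re w\<bar> + \<bar>re (j * w)\<bar>"
proof (cases "range (to_complex :: 'k \<Rightarrow> complex) = UNIV")
  case True
  then obtain j :: 'k where j: "to_complex j = \<i>" by (metis rangeE UNIV_I)
  have "norm w \<le> \<bar>re w\<bar> + \<bar>re (j * w)\<bar>" for w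
    using cmod_le[of "to_complex w"] by (simp add: to_complex_mult j norm_to_complex)
  then show ?thesis by blast
next
  case False
  then have "to_complex w \<in> \<real>" for w :: 'k
    using range_to_complex[where 'a = 'k] by blast
  then have "norm w \<le> \<bar>re w\<bar>" for w :: 'k
    by (metis complex_is_Real_iff cmod_eq_Re norm_to_complex order_refl)
  then show ?thesis by (intro exI[of _ 0]) (simp add: to_complex_zero)
qed

text \<open>
  One half of a theorem of Smulian. The bound \<open>re ((f + s h)(u n)) \<le> norm (f + s h)\<close> compares \<open>s re (h (u n))\<close>
  with the increment of the norm, up to the gap between \<open>norm f\<close> and \<open>re (f (u n))\<close>. A small
  positive \<open>s\<close> gives the upper and a negative one the lower estimate, and both difference quotients
  are near the derivative. The limit does not depend on the sequence.
\<close>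

lemma smo_maximizing_sequence_re:
  assumes f: "f \<in> smo_dual scale"
  shows "\<exists>D. \<forall>h\<in>dual scale. \<forall>u. (\<forall>n. norm (u n) \<le> 1) \<and> (\<lambda>n. re (blinfun_apply f (u n))) \<longlonglongrightarrow> norm f
    \<longrightarrow> (\<lambda>n. re (blinfun_apply h (u n))) \<longlonglongrightarrow> D h"
proof -
  obtain D where D: "\<And>h. h \<in> dual scale \<Longrightarrow> ((\<lambda>t::real. (norm (f + t *\<^sub>R h) - norm f) / t) \<longlongrightarrow> D h) (at 0)"
    using f unfolding smo_dual_def by blast
  have "(\<lambda>n. re (blinfun_apply h (u n))) \<longlonglongrightarrow> D h"
    if h: "h \<in> dual scale" and u: "\<And>n. norm (u n) \<le> 1"
      and lim: "(\<lambda>n. re (blinfun_apply f (u n))) \<longlonglongrightarrow> norm f" for h u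
  proof (rule LIMSEQ_I)
    fix \<epsilon> :: real assume "\<epsilon> > 0"
    then obtain d where d: "d > 0"
        "\<And>t. t \<noteq> 0 \<Longrightarrow> \<bar>t\<bar> < d \<Longrightarrow> \<bar>(norm (f + t *\<^sub>R h) - norm f) / t - D h\<bar> < \<epsilon> / 2"
      using LIM_D[OF D[OF h], of "\<epsilon> / 2"] by auto
    define t where "t = d / 2"
    have t: "0 < t" "t < d" using d by (auto simp: t_def)
    have gap: "s * re (blinfun_apply h (u n)) \<le> norm (f + s *\<^sub>R h) - re (blinfun_apply f (u n))" for s n
    proof -
      have "re (blinfun_apply (f + s *\<^sub>R h) (u n)) \<le> norm (f + s *\<^sub>R h)"
        using re_le_norm norm_apply_le_ball[OF u] order_trans by blast
      then show ?thesis by (simp add: blinfun.add_left blinfun.scaleR_left to_complex_add to_complex_scaleR)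
    qed
    have "t * \<epsilon> / 2 > 0" using t \<open>\<epsilon> > 0\<close> by simp
    then obtain N where N: "\<And>n. n \<ge> N \<Longrightarrow> \<bar>re (blinfun_apply f (u n)) - norm f\<bar> < t * \<epsilon> / 2"
      using LIMSEQ_D[OF lim] by (metis real_norm_def)
    have "\<bar>re (blinfun_apply h (u n)) - D h\<bar> < \<epsilon>" if n: "n \<ge> N" for n
    proof -
      let ?p = "norm (f + t *\<^sub>R h) - norm f" and ?q = "norm (f + (- t) *\<^sub>R h) - norm f"
      have "\<bar>?p / t - D h\<bar> < \<epsilon> / 2" using d(2)[of t] t by simp
      then have "?p / t < D h + \<epsilon> / 2" by linarith
      then have p: "?p < (D h + \<epsilon> / 2) * t" using t by (simp add: pos_divide_less_eq)
      have "\<bar>?q / (- t) - D h\<bar> < \<epsilon> / 2" using d(2)[of "- t"] t by simp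
      then have "?q / t < - D h + \<epsilon> / 2" unfolding minus_divide_right[symmetric] by linarith
      then have q: "?q < (- D h + \<epsilon> / 2) * t" using t by (simp add: pos_divide_less_eq)
      have "t * re (blinfun_apply h (u n)) < (D h + \<epsilon> / 2) * t + t * \<epsilon> / 2"
        using gap[of t n] p N[OF n] by linarith
      then have "t * re (blinfun_apply h (u n)) < t * (D h + \<epsilon>)" by (simp add: algebra_simps)
      moreover have "(- t) * re (blinfun_apply h (u n)) < (- D h + \<epsilon> / 2) * t + t * \<epsilon> / 2"
        using gap[of "- t" n] q N[OF n] by linarith
      then have "t * (D h - \<epsilon>) < t * re (blinfun_apply h (u n))" by (simp add: algebra_simps)
      ultimately show ?thesis using t by (simp add: abs_less_iff)
    qed
    then show "\<exists>N. \<forall>n\<ge>N. norm (re (blinfun_apply h (u n)) - D h) < \<epsilon>" by auto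
  qed
  then show ?thesis by blast
qed

text \<open>The constant sequence \<open>x0\<close> is maximizing too, which identifies the limit.\<close>

lemma smo_maximizing_sequence:
  assumes f: "f \<in> smo_dual scale" and x0: "norm x0 \<le> 1" "re (blinfun_apply f x0) = norm f"
    and u: "\<And>n. norm (u n) \<le> 1" "(\<lambda>n. re (blinfun_apply f (u n))) \<longlonglongrightarrow> norm f"
    and h: "h \<in> dual scale"
  shows "(\<lambda>n. blinfun_apply h (u n)) \<longlonglongrightarrow> blinfun_apply h x0"
proof -
  have re_lim: "(\<lambda>n. re (blinfun_apply h (u n))) \<longlonglongrightarrow> re (blinfun_apply h x0)" if "h \<in> dual scale" for h
  proof -
    obtain D where D: "\<And>u. (\<forall>n. norm (u n) \<le> 1) \<Longrightarrow> (\<lambda>n. re (blinfun_apply f (u n))) \<longlonglongrightarrow> norm f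
        \<Longrightarrow> (\<lambda>n. re (blinfun_apply h (u n))) \<longlonglongrightarrow> D h"
      using smo_maximizing_sequence_re[OF f] \<open>h \<in> dual scale\<close> by blast
    have "(\<lambda>n::nat. re (blinfun_apply h x0)) \<longlonglongrightarrow> D h"
      using D[of "\<lambda>_. x0"] x0 by simp
    then have "re (blinfun_apply h x0) = D h" by (simp add: LIMSEQ_const_iff)
    then show ?thesis using D u by simp
  qed
  obtain j where j: "\<And>w::'k. norm w \<le> \<bar>re w\<bar> + \<bar>re (j * w)\<bar>"
    using exists_norm_le_re by blast
  have "scale_functional j h \<in> dual scale"
    using h by (simp add: dual_def scale_functional_apply)
  then have j_lim: "(\<lambda>n. re (j * blinfun_apply h (u n))) \<longlonglongrightarrow> re (j * blinfun_apply h x0)"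
    using re_lim by (fastforce simp: scale_functional_apply)
  let ?d = "\<lambda>n. blinfun_apply h (u n) - blinfun_apply h x0"
  have "(\<lambda>n. \<bar>re (blinfun_apply h (u n)) - re (blinfun_apply h x0)\<bar>
      + \<bar>re (j * blinfun_apply h (u n)) - re (j * blinfun_apply h x0)\<bar>)
      \<longlonglongrightarrow> \<bar>re (blinfun_apply h x0) - re (blinfun_apply h x0)\<bar>
        + \<bar>re (j * blinfun_apply h x0) - re (j * blinfun_apply h x0)\<bar>"
    by (intro tendsto_intros re_lim j_lim h)
  moreover have "norm (?d n) \<le> \<bar>re (blinfun_apply h (u n)) - re (blinfun_apply h x0)\<bar>
      + \<bar>re (j * blinfun_apply h (u n)) - re (j * blinfun_apply h x0)\<bar>" for n
    using j[of "?d n"] by (simp add: right_diff_distrib to_complex_diff)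
  ultimately have "?d \<longlonglongrightarrow> 0"
    by (intro Lim_null_comparison[of ?d]) (auto intro: always_eventually)
  then show ?thesis
    by (rule LIM_zero_cancel)
qed

lemma NA_maximizer:
  assumes "f \<in> NA scale"
  shows "\<exists>x0. norm x0 \<le> 1 \<and> re (blinfun_apply f x0) = norm f"
proof -
  obtain x where f: "f \<in> dual scale" and x: "norm x \<le> 1" "norm (blinfun_apply f x) = norm f"
    using assms unfolding NA_def by blast
  obtain \<theta> where "norm \<theta> = 1" "\<theta> * blinfun_apply f x = of_real (norm (blinfun_apply f x))"
    using exists_phase by blast
  then show ?thesis
    using x by (intro exI[of _ "scale \<theta> x"]) (simp add: norm_scale apply_dual_scale[OF f] re_of_real)
qed

end

lemma controlled_maximizing_sequence:
  fixes R :: "'x::banach \<Rightarrow>\<^sub>L 'y::banach" and f :: "'x \<Rightarrow>\<^sub>L 'k::real_or_complex"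
  assumes t0: "t0 > 0" "\<forall>t x. 0 < t \<longrightarrow> t \<le> t0 \<longrightarrow> norm x \<le> 1 \<longrightarrow> norm R - t < norm (blinfun_apply R x) \<longrightarrow>
        norm f - 2 * t \<le> norm (blinfun_apply f x)"
    and xs: "\<And>n. norm (xs n) \<le> 1" and lim: "(\<lambda>n. norm (blinfun_apply R (xs n))) \<longlonglongrightarrow> norm R"
  shows "(\<lambda>n. norm (blinfun_apply f (xs n))) \<longlonglongrightarrow> norm f"
proof (rule LIMSEQ_I)
  fix \<epsilon> :: real assume "\<epsilon> > 0"
  define t where "t = min t0 (\<epsilon> / 3)"
  have t: "0 < t" "t \<le> t0" "2 * t < \<epsilon>" using t0 \<open>\<epsilon> > 0\<close> by (auto simp: t_def)
  obtain N where N: "\<And>n. n \<ge> N \<Longrightarrow> \<bar>norm (blinfun_apply R (xs n)) - norm R\<bar> < t"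
    using LIMSEQ_D[OF lim t(1)] by auto
  have "norm (norm (blinfun_apply f (xs n)) - norm f) < \<epsilon>" if "n \<ge> N" for n
  proof -
    have "norm R - t < norm (blinfun_apply R (xs n))" using N[OF that] by linarith
    then have "norm f - 2 * t \<le> norm (blinfun_apply f (xs n))"
      using t0(2) t xs by blast
    then show ?thesis
      using norm_apply_le_ball[OF xs, of f n] t by simp
  qed
  then show "\<exists>N. \<forall>n\<ge>N. norm (norm (blinfun_apply f (xs n)) - norm f) < \<epsilon>" by blast
qed

section \<open>Density of absolutely strongly exposing operators\<close>

theorem theorem4p1:
  fixes sX :: "'k::real_or_complex \<Rightarrow> 'x::banach \<Rightarrow> 'x"
    and sY :: "'k \<Rightarrow> 'y::banach \<Rightarrow> 'y"
    and \<Gamma> :: "('y \<Rightarrow>\<^sub>L 'k) set"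
    and \<rho> :: "('y \<Rightarrow>\<^sub>L 'k) \<Rightarrow> real"
    and T :: "'x \<Rightarrow>\<^sub>L 'y"
  assumes "K_banach sX" and "K_banach sY"
    and "quasi_ACK sY \<Gamma> \<rho>"
    and "T \<in> K_operators sX sY"
    and "flat_operator sY \<Gamma> T"
    and "\<And>\<Gamma>\<^sub>0. \<Gamma>\<^sub>0 \<subseteq> \<Gamma> \<Longrightarrow> flat_operator sY \<Gamma>\<^sub>0 T"
  shows "(dual sX \<subseteq> closure (SE sX) \<longrightarrow>
            (\<forall>\<epsilon>>0. \<exists>R \<in> ASE sX sY. norm (R - T) < \<epsilon>)) \<and>
         (dual sX \<subseteq> closure (smo_dual sX \<inter> NA sX) \<longrightarrow>
            (\<forall>\<epsilon>>0. \<exists>R \<in> K_operators sX sY. norm (R - T) < \<epsilon> \<and>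
              (\<exists>x0 \<in> sphere 0 1. norm (blinfun_apply R x0) = norm R \<and>
                (\<forall>xs. (\<forall>n::nat. xs n \<in> cball 0 1) \<and>
                   (\<lambda>n. norm (blinfun_apply R (xs n))) \<longlonglongrightarrow> norm R \<longrightarrow>
                   (\<exists>\<sigma> \<theta>. strict_mono \<sigma> \<and> norm \<theta> = 1 \<and>
                     (\<forall>f \<in> dual sX. (\<lambda>n. blinfun_apply f (xs (\<sigma> n)))
                        \<longlonglongrightarrow> blinfun_apply f (sX \<theta> x0)))))))"
proof -
  interpret K_banach_pair sX sY
    using assms(1,2) by (simp add: K_banach_pair_def)
  have zero_dual: "0 \<in> dual sX" by (simp add: dual_def)
  have a: "\<exists>R \<in> ASE sX sY. norm (R - T) < \<epsilon>" if dense: "dual sX \<subseteq> closure (SE sX)" and "\<epsilon> > 0" for \<epsilon>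
  proof -
    have SE: "SE sX \<subseteq> dual sX" "0 \<notin> SE sX" by (auto simp: SE_def)
    have "SE sX \<noteq> {}" using dense zero_dual by auto
    then obtain g where g: "g \<in> dual sX" "g \<noteq> 0" using SE by blast
    obtain R f t0 where R: "R \<in> K_operators sX sY" "f \<in> SE sX" "norm (R - T) < \<epsilon>"
        and t0: "t0 > 0" "\<forall>t x. 0 < t \<longrightarrow> t \<le> t0 \<longrightarrow> norm x \<le> 1 \<longrightarrow> norm R - t < norm (blinfun_apply R x) \<longrightarrow>
          norm f - 2 * t \<le> norm (blinfun_apply f x)"
      using flat_operators_approximable[OF assms(3,4,6) SE(1) dense g \<open>\<epsilon> > 0\<close>] by blast
    obtain x0 where x0: "norm x0 = 1"
        "\<And>u. (\<forall>n. norm (u n) \<le> 1) \<and> (\<lambda>n. re (blinfun_apply f (u n))) \<longlonglongrightarrow> norm f \<Longrightarrow> u \<longlonglongrightarrow> x0"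
      using X.SE_maximizer[OF R(2)] by blast
    have "\<exists>\<sigma> \<theta>. strict_mono \<sigma> \<and> norm \<theta> = 1 \<and> (xs \<circ> \<sigma>) \<longlonglongrightarrow> sX \<theta> x0"
      if xs: "\<forall>n::nat. xs n \<in> cball 0 1" and lim: "(\<lambda>n. norm (blinfun_apply R (xs n))) \<longlonglongrightarrow> norm R" for xs
    proof -
      have xs1: "norm (xs n) \<le> 1" for n using xs by simp
      have "f \<in> dual sX" using R(2) SE by blast
      then obtain \<sigma> \<theta> \<psi> u where \<sigma>: "strict_mono \<sigma>" "norm \<theta> = 1" "\<psi> \<longlonglongrightarrow> \<theta>" "\<forall>n. norm (u n) \<le> 1"
          "\<forall>n. xs (\<sigma> n) = sX (\<psi> n) (u n)" "(\<lambda>n. re (blinfun_apply f (u n))) \<longlonglongrightarrow> norm f"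
        using X.phase_aligned_subsequence[OF _ xs1 controlled_maximizing_sequence[OF t0 xs1 lim]] by blast
      have "(\<lambda>n. sX (\<psi> n) (u n)) \<longlonglongrightarrow> sX \<theta> x0"
        using \<sigma>(4,6) x0(2) by (intro X.tendsto_scale \<sigma>(3)) auto
      then show ?thesis
        using \<sigma>(1,2,5) by (intro exI[of _ \<sigma>] exI[of _ \<theta>]) (simp add: o_def)
    qed
    then have "R \<in> ASE sX sY"
      unfolding ASE_def using R(1) x0(1) by (intro CollectI conjI bexI[of _ x0]) auto
    then show ?thesis using R(3) by blast
  qed
  have b: "\<exists>R \<in> K_operators sX sY. norm (R - T) < \<epsilon> \<and>
      (\<exists>x0 \<in> sphere 0 1. norm (blinfun_apply R x0) = norm R \<and>
        (\<forall>xs. (\<forall>n::nat. xs n \<in> cball 0 1) \<and> (\<lambda>n. norm (blinfun_apply R (xs n))) \<longlonglongrightarrow> norm R \<longrightarrow>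
           (\<exists>\<sigma> \<theta>. strict_mono \<sigma> \<and> norm \<theta> = 1 \<and>
             (\<forall>f \<in> dual sX. (\<lambda>n. blinfun_apply f (xs (\<sigma> n))) \<longlonglongrightarrow> blinfun_apply f (sX \<theta> x0)))))"
    if dense: "dual sX \<subseteq> closure (smo_dual sX \<inter> NA sX)" and "\<epsilon> > 0" for \<epsilon>
  proof (cases "dual sX = {0}")
    case True
    \<comment> \<open>Without nonzero functionals on \<open>X\<close> an operator into \<open>Y\<close> vanishes, since its composition
      with every functional in the norming set does, and weak convergence is no condition.\<close>
    have "norm T \<le> 0"
    proof (rule norm_le_by_norming)
      show norming: "one_norming sY \<Gamma>" using assms(3) by (simp add: quasi_ACK_def)
      show "norm (adjoint_op T y) \<le> 0" if "y \<in> \<Gamma>" for y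
        using adjoint_dual[OF assms(4), of y] that Y.one_norming_subset[OF norming] True
        by (auto simp: dual_ball_def)
    qed
    then have "T = 0" by simp
    obtain x :: 'x where "x \<noteq> 0" using X.nonzero by blast
    then have x: "x /\<^sub>R norm x \<in> sphere 0 1" by simp
    have "\<exists>\<sigma> \<theta>. strict_mono \<sigma> \<and> norm \<theta> = 1 \<and> (\<forall>f \<in> dual sX.
        (\<lambda>n. blinfun_apply f (xs (\<sigma> n))) \<longlonglongrightarrow> blinfun_apply f (sX \<theta> (x /\<^sub>R norm x)))" for xs :: "nat \<Rightarrow> 'x"
      by (intro exI[of _ "id :: nat \<Rightarrow> nat"] exI[of _ "1 :: 'k"]) (simp add: True strict_mono_def)
    then show ?thesis
      using x \<open>T = 0\<close> \<open>\<epsilon> > 0\<close> assms(4) by (intro bexI[of _ T] conjI bexI[of _ "x /\<^sub>R norm x"]) auto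
  next
    case False
    then obtain g where g: "g \<in> dual sX" "g \<noteq> 0" using zero_dual by blast
    have sub: "smo_dual sX \<inter> NA sX \<subseteq> dual sX" by (auto simp: NA_def)
    obtain R f t0 where f: "f \<in> smo_dual sX \<inter> NA sX" and R: "R \<in> K_operators sX sY" "norm (R - T) < \<epsilon>" "f \<noteq> 0"
          "norm R = norm f" "\<forall>x. norm (blinfun_apply f x) \<le> norm (blinfun_apply R x)"
        and t0: "t0 > 0" "\<forall>t x. 0 < t \<longrightarrow> t \<le> t0 \<longrightarrow> norm x \<le> 1 \<longrightarrow> norm R - t < norm (blinfun_apply R x) \<longrightarrow>
          norm f - 2 * t \<le> norm (blinfun_apply f x)"
      using flat_operators_approximable[OF assms(3,4,6) sub dense g \<open>\<epsilon> > 0\<close>] by blast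
    obtain x0 where x0: "norm x0 \<le> 1" "re (blinfun_apply f x0) = norm f"
      using X.NA_maximizer[of f] f by blast
    have x01: "norm x0 = 1" using X.norm_eq_one_if_attains[OF R(3) x0] .
    have "norm f \<le> norm (blinfun_apply R x0)"
      using x0(2) re_le_norm[of "blinfun_apply f x0"] R(5) by (metis order_trans)
    then have attains: "norm (blinfun_apply R x0) = norm R"
      using norm_apply_le_ball[OF x0(1), of R] R(4) by simp
    have "\<exists>\<sigma> \<theta>. strict_mono \<sigma> \<and> norm \<theta> = 1 \<and>
        (\<forall>h \<in> dual sX. (\<lambda>n. blinfun_apply h (xs (\<sigma> n))) \<longlonglongrightarrow> blinfun_apply h (sX \<theta> x0))"
      if xs: "\<forall>n::nat. xs n \<in> cball 0 1" and lim: "(\<lambda>n. norm (blinfun_apply R (xs n))) \<longlonglongrightarrow> norm R" for xs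
    proof -
      have xs1: "norm (xs n) \<le> 1" for n using xs by simp
      have "f \<in> dual sX" using f sub by blast
      then obtain \<sigma> \<theta> \<psi> u where \<sigma>: "strict_mono \<sigma>" "norm \<theta> = 1" "\<psi> \<longlonglongrightarrow> \<theta>" "\<forall>n. norm (u n) \<le> 1"
          "\<forall>n. xs (\<sigma> n) = sX (\<psi> n) (u n)" "(\<lambda>n. re (blinfun_apply f (u n))) \<longlonglongrightarrow> norm f"
        using X.phase_aligned_subsequence[OF _ xs1 controlled_maximizing_sequence[OF t0 xs1 lim]] by blast
      have "(\<lambda>n. blinfun_apply h (xs (\<sigma> n))) \<longlonglongrightarrow> blinfun_apply h (sX \<theta> x0)" if h: "h \<in> dual sX" for h
        using tendsto_mult[OF \<sigma>(3) X.smo_maximizing_sequence[OF IntD1[OF f] x0 _ \<sigma>(6) h]] \<sigma>(4,5)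
        by (simp add: X.apply_dual_scale[OF h])
      then show ?thesis using \<sigma>(1,2) by blast
    qed
    then show ?thesis
      using R(1,2) x01 attains by (intro bexI[of _ R] conjI bexI[of _ x0]) auto
  qed
  show ?thesis using a b by blast
qed

end
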